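(* Let $\tau\subset\mathfrak c(\Phi)$ be a $\Phi$-tope and let $z(\Phi,\tau,B)$, $B\subseteq\{1,\dots,N\}$, be the coefficients of the Combinatorial Brianchon-Gram polynomial: $$X(\Phi,\tau)=\sum_{B\subseteq\{1,\dots,N\}}z(\Phi,\tau,B)\prod_{i\notin B}p_i\prod_{i\in B}q_i .$$ (i) If $B=\emptyset$ then $z(\Phi,\tau,B)=1$, while if $B=\{1,2,\dots,N\}$ then $z(\Phi,\tau,B)=(-1)^d$. (ii) If $z(\Phi,\tau,B)\ne 0$, then the cone $\mathfrak c(\Phi_{\rm flip}^B)$ is salient. (iii) More precisely, if $z(\Phi,\tau,B)\neq 0$, choose $x=(x_i)\in Q_{\rm neg}^B$ such that $\lambda=\sum_i x_i\phi_i$ is a regular element of $F$, and let $\nu$ be the tope containing $\lambda$. Then $B$ occurs in the list $\mathcal A(\nu,\tau)$ and $$z(\Phi,\tau,B)=(-1)^{|B|}\sum_{[\epsilon,B]\in\mathcal A(\nu,\tau)}\epsilon ,$$ where the sum is over all entries of the list $\mathcal A(\nu,\tau)$ whose subset is $B$, counted with multiplicity.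
   Context: $F$ is a real vector space of dimension $r$; $\Phi=(\phi_1,\dots,\phi_N)$ is a sequence of nonzero elements of $F$ which generates $F$ and such that the cone $\mathfrak c(\Phi)=\{\sum_i t_i\phi_i:t_i\ge 0\}$ is salient (contains no affine line). $d=N-r$. For $A\subseteq\{1,\dots,N\}$, $\Phi_{\rm flip}^A=(\sigma_i\phi_i)_{1\le i\le N}$ with $\sigma_i=-1$ if $i\in A$, $\sigma_i=1$ if $i\notin A$; $\mathfrak c(\Phi_{\rm flip}^A)$ is the closed convex cone generated by its elements. $Q_{\rm neg}^B=\{x\in\mathbb R^N:x_i<0\text{ for }i\in B,\ x_i\ge 0\text{ for }i\notin B\}$. A $\Phi$-wall is a hyperplane of $F$ spanned by $r-1$ linearly independent elements of $\Phi$; an element of $F$ is regular if it lies on no wall; a $\Phi$-tope is a connected component of the set of regular elements. (All $\Phi_{\rm flip}^A$ have the same walls and topes as $\Phi$.) Two topes are adjacent if the intersection of their closures is contained in a wall and spans this wall (their common wall). $\mathcal G(\Phi,\tau)$ is the set of $I\subseteq\{1,\dots,N\}$ such that $\{\phi_i,i\in I\}$ generates $F$ and $\tau$ is contained in the cone generated by $\{\phi_i,i\in I\}$; with $I^c$ the complement of $I$, $X(\Phi,\tau)=\sum_{I\in\mathcal G(\Phi,\tau)}(-1)^{|I|-\dim F}\prod_{i\in I^c}p_i\prod_{i\in I}(p_i+q_i)$. The list $\mathcal A(\nu,\tau)$: for a sequence $\Psi=(\psi_i)_{1\le i\le N}$ with the same walls and adjacent topes $\tau',\tau''$, let $A(\Psi,\tau',\tau'')$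 be the set of $i$ such that $\psi_i$ belongs to the open side of the common wall which contains $\tau'$. Choose a sequence of topes $\tau_1=\tau,\tau_2,\dots,\tau_\ell=\nu$ with $\tau_{k+1}$ adjacent to $\tau_k$ for $1\le k\le\ell-1$. For each sequence $K=(1\le k_1<\dots<k_s\le\ell-1)$ define $A_K\subseteq\{1,\dots,N\}$ recursively: $A_\emptyset=\emptyset$, and for $s\ge 1$, with $A=A_{(k_1,\dots,k_{s-1})}$, $$A_K=A\,\triangle\,A(\Phi_{\rm flip}^A,\tau_{k_s},\tau_{k_s+1}),$$ where $\triangle$ is the symmetric difference. Then $\mathcal A(\nu,\tau)$ is the list (with repetitions, indexed by all $K$) of the signed subsets $[(-1)^{|K|},A_K]$, where $|K|=s$. The list depends on the choice of the path of topes, which is arbitrary and fixed. *)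

theory Defs
  imports "HOL-Analysis.Analysis" "HOL-Library.Poly_Mapping"
begin

text \<open>
  A finite-dimensional real vector space is rendered as a linear subspace \<open>F\<close> of a Euclidean
  space, so that dimension \<open>0\<close> is included.  The inner product is never used; the norm only
  provides the canonical topology of \<open>F\<close>.
  A sequence \<open>(\<phi>\<^sub>1, \<dots>, \<phi>\<^sub>N)\<close> is a function on \<open>nat\<close> of which only the
  values on \<open>{1..N}\<close> matter.
\<close>

definition gen_cone :: "(nat \<Rightarrow> 'a::real_vector) \<Rightarrow> nat set \<Rightarrow> 'a set" where
  "gen_cone \<phi> I = {\<Sum>i\<in>I. t i *\<^sub>R \<phi> i | t :: nat \<Rightarrow> real. \<forall>i\<in>I. t i \<ge> 0}"

definition salient :: "'a::real_vector set \<Rightarrow> bool" where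
  "salient C \<longleftrightarrow> \<not> (\<exists>x v. v \<noteq> 0 \<and> (\<forall>t::real. x + t *\<^sub>R v \<in> C))"

definition flip :: "nat set \<Rightarrow> (nat \<Rightarrow> 'a::real_vector) \<Rightarrow> nat \<Rightarrow> 'a" where
  "flip A \<phi> = (\<lambda>i. if i \<in> A then - \<phi> i else \<phi> i)"

definition Q_neg :: "nat \<Rightarrow> nat set \<Rightarrow> (nat \<Rightarrow> real) set" where
  "Q_neg N B = {x. \<forall>i\<in>{1..N}. if i \<in> B then x i < 0 else x i \<ge> 0}"


subsection \<open>Walls and topes\<close>

text \<open>The condition \<open>card S + 1 = dim F\<close> avoids truncated subtraction: there are no walls
  if \<open>dim F = 0\<close>.\<close>

definition walls :: "'a::euclidean_space set \<Rightarrow> nat \<Rightarrow> (nat \<Rightarrow> 'a) \<Rightarrow> 'a set set" where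
  "walls F N \<phi> = {span S | S. S \<subseteq> \<phi> ` {1..N} \<and> independent S \<and> card S + 1 = dim F}"

definition regular :: "'a::euclidean_space set \<Rightarrow> nat \<Rightarrow> (nat \<Rightarrow> 'a) \<Rightarrow> 'a set" where
  "regular F N \<phi> = F - \<Union>(walls F N \<phi>)"

definition topes :: "'a::euclidean_space set \<Rightarrow> nat \<Rightarrow> (nat \<Rightarrow> 'a) \<Rightarrow> 'a set set" where
  "topes F N \<phi> = components (regular F N \<phi>)"

definition adjacent ::
    "'a::euclidean_space set \<Rightarrow> nat \<Rightarrow> (nat \<Rightarrow> 'a) \<Rightarrow> 'a set \<Rightarrow> 'a set \<Rightarrow> bool" where
  "adjacent F N \<phi> \<tau>1 \<tau>2 \<longleftrightarrow>
     (\<exists>W\<in>walls F N \<phi>. closure \<tau>1 \<inter> closure \<tau>2 \<subseteq> W \<and> span (closure \<tau>1 \<inter> closure \<tau>2) = W)"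

definition common_wall :: "'a::euclidean_space set \<Rightarrow> 'a set \<Rightarrow> 'a set" where
  "common_wall \<tau>1 \<tau>2 = span (closure \<tau>1 \<inter> closure \<tau>2)"

definition open_side :: "'a::euclidean_space set \<Rightarrow> 'a set \<Rightarrow> 'a set \<Rightarrow> bool" where
  "open_side F W H \<longleftrightarrow>
     (\<exists>f :: 'a \<Rightarrow> real. linear f \<and> W = {x\<in>F. f x = 0} \<and> H = {x\<in>F. f x > 0})"

definition side_indices ::
    "'a::euclidean_space set \<Rightarrow> nat \<Rightarrow> (nat \<Rightarrow> 'a) \<Rightarrow> 'a set \<Rightarrow> 'a set \<Rightarrow> nat set" where
  "side_indices F N \<psi> \<tau>1 \<tau>2 =
     {i\<in>{1..N}. \<exists>H. open_side F (common_wall \<tau>1 \<tau>2) H \<and> \<tau>1 \<subseteq> H \<and> \<psi> i \<in> H}"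


subsection \<open>The list of signed subsets attached to a path of topes\<close>

text \<open>A path \<open>\<tau>\<^sub>1 = \<tau>, \<dots>, \<tau>\<^sub>l = \<nu>\<close> is a function \<open>T\<close> on \<open>{1..l}\<close>.\<close>

definition tope_path ::
    "'a::euclidean_space set \<Rightarrow> nat \<Rightarrow> (nat \<Rightarrow> 'a) \<Rightarrow> 'a set \<Rightarrow> 'a set \<Rightarrow> nat \<Rightarrow> (nat \<Rightarrow> 'a set) \<Rightarrow> bool"
  where
  "tope_path F N \<phi> \<tau> \<nu> l T \<longleftrightarrow>
     l \<ge> 1 \<and> T 1 = \<tau> \<and> T l = \<nu> \<and> (\<forall>k\<in>{1..l}. T k \<in> topes F N \<phi>) \<and>
     (\<forall>k\<in>{1..<l}. adjacent F N \<phi> (T k) (T (Suc k)))"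

text \<open>The fold processes \<open>K = [k\<^sub>1, \<dots>, k\<^sub>s]\<close> from the left, so the set for \<open>K\<close> is obtained
  from the one for \<open>[k\<^sub>1, \<dots>, k\<^sub>s\<^sub>-\<^sub>1]\<close> by crossing the wall at \<open>k\<^sub>s\<close>.\<close>

definition flip_set ::
    "'a::euclidean_space set \<Rightarrow> nat \<Rightarrow> (nat \<Rightarrow> 'a) \<Rightarrow> (nat \<Rightarrow> 'a set) \<Rightarrow> nat list \<Rightarrow> nat set" where
  "flip_set F N \<phi> T K =
     foldl (\<lambda>A k. sym_diff A (side_indices F N (flip A \<phi>) (T k) (T (Suc k)))) {} K"

text \<open>Since \<open>[1..<l]\<close> is strictly increasing, \<open>subseqs [1..<l]\<close> enumerates every strictly
  increasing sequence in \<open>{1, \<dots>, l - 1}\<close> exactly once.\<close>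

definition signed_list ::
    "'a::euclidean_space set \<Rightarrow> nat \<Rightarrow> (nat \<Rightarrow> 'a) \<Rightarrow> nat \<Rightarrow> (nat \<Rightarrow> 'a set) \<Rightarrow> (int \<times> nat set) list"
  where
  "signed_list F N \<phi> l T =
     map (\<lambda>K. ((- 1) ^ length K, flip_set F N \<phi> T K)) (subseqs [1..<l])"


subsection \<open>The Combinatorial Brianchon-Gram polynomial\<close>

text \<open>Polynomials over the integers in variables \<open>p\<^sub>i\<close>, \<open>q\<^sub>i\<close> are finitely supported maps
  from monomials (finitely supported exponent vectors) to coefficients, with convolution as
  product.\<close>

datatype var = P nat | Q nat

type_synonym pq_poly = "(var \<Rightarrow>\<^sub>0 nat) \<Rightarrow>\<^sub>0 int"

definition pvar :: "nat \<Rightarrow> pq_poly" where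
  "pvar i = Poly_Mapping.single (Poly_Mapping.single (P i) 1) 1"

definition qvar :: "nat \<Rightarrow> pq_poly" where
  "qvar i = Poly_Mapping.single (Poly_Mapping.single (Q i) 1) 1"

definition gen_sets ::
    "'a::euclidean_space set \<Rightarrow> nat \<Rightarrow> (nat \<Rightarrow> 'a) \<Rightarrow> 'a set \<Rightarrow> nat set set" where
  "gen_sets F N \<phi> \<tau> = {I. I \<subseteq> {1..N} \<and> span (\<phi> ` I) = F \<and> \<tau> \<subseteq> gen_cone \<phi> I}"

text \<open>The subtraction in the exponent is never truncated: a generating family has at least
  \<open>dim F\<close> members.\<close>

definition BG_poly :: "'a::euclidean_space set \<Rightarrow> nat \<Rightarrow> (nat \<Rightarrow> 'a) \<Rightarrow> 'a set \<Rightarrow> pq_poly" where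
  "BG_poly F N \<phi> \<tau> =
     (\<Sum>I\<in>gen_sets F N \<phi> \<tau>.
        (- 1) ^ (card I - dim F) * (\<Prod>i\<in>{1..N} - I. pvar i) * (\<Prod>i\<in>I. pvar i + qvar i))"

text \<open>The coefficient of the monomial \<open>\<Prod>\<^bsub>i \<notin> B\<^esub> p\<^sub>i \<Prod>\<^bsub>i \<in> B\<^esub> q\<^sub>i\<close>.\<close>

definition z_coeff ::
    "'a::euclidean_space set \<Rightarrow> nat \<Rightarrow> (nat \<Rightarrow> 'a) \<Rightarrow> 'a set \<Rightarrow> nat set \<Rightarrow> int" where
  "z_coeff F N \<phi> \<tau> B =
     Poly_Mapping.lookup (BG_poly F N \<phi> \<tau>)
       ((\<Sum>i\<in>{1..N} - B. Poly_Mapping.single (P i) 1) + (\<Sum>i\<in>B. Poly_Mapping.single (Q i) 1))"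

end

theory Submission
  imports Defs
begin

text \<open>
  Let \<open>a\<close> be a point of the tope \<open>\<tau>\<close>.  Up to the sign \<open>(- 1) ^ dim F\<close>, the coefficient \<open>z(B)\<close> is the
  sum of \<open>(- 1) ^ card I\<close> over all \<open>I \<supseteq> B\<close> such that \<open>a\<close> lies in the cone generated by the \<open>\<phi> i\<close>,
  \<open>i \<in> I\<close>.  These \<open>I\<close> correspond to the faces \<open>{y. \<forall>i\<notin>I. y i = 0}\<close> of the polytope of all
  \<open>y \<ge> 0\<close> with \<open>(\<Sum>i. y i *\<^sub>R \<phi> i) = a\<close>.  Regularity of \<open>a\<close> makes this polytope simple, and salience
  of the cone makes it bounded.

  Such sums over faces are evaluated by linear programming.  A generic cost \<open>c\<close> attains its minimum
  over each face at exactly one vertex.  Vertices are bases \<open>J\<close> with \<open>a\<close> in the cone of \<open>J\<close>, and the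
  faces with optimal vertex \<open>J\<close> form an interval \<open>J \<subseteq> I \<subseteq> J \<union> W J\<close>, where \<open>W J\<close> consists of the
  edge directions of increasing cost.  An alternating sum over an interval, restricted to
  \<open>I \<supseteq> B\<close>, vanishes unless \<open>B - J = W J\<close>.  So the whole sum is a sum over the vertices that satisfy
  this equation (lemma \<open>signed_count_vertex_bases\<close>).  The choice of the cost is free:

  \<^item> for \<open>B = {}\<close> exactly one vertex survives, the one of maximal cost, and \<open>z({}) = 1\<close>
    (\<open>signed_count_empty\<close>);

  \<^item> if \<open>a = (\<Sum>i. x i *\<^sub>R \<phi> i)\<close> where \<open>x\<close> is \<open>\<le> 0\<close> on \<open>B \<noteq> {}\<close> and \<open>\<ge> 0\<close> elsewhere, then a cost that
    separates such a point from the polytope leaves no vertex, and \<open>z(B) = 0\<close>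
    (\<open>signed_count_orthant\<close>);

  \<^item> if there is a nontrivial relation \<open>(\<Sum>i. v i *\<^sub>R \<phi> i) = 0\<close> with the same sign pattern, then the
    cost \<open>v\<close>, suitably perturbed, leaves no vertex, and \<open>z(B) = 0\<close> (\<open>signed_count_recession\<close>).

  The last item is part (ii), because a relation of this sign pattern is the same as a nonnegative
  relation between the vectors of \<open>flip B \<phi>\<close>, and such relations exist exactly when the flipped
  cone fails to be salient.

  Part (iii) compares \<open>a\<close> with a point in another tope.  Write \<open>w(\<psi>, a, B)\<close> for \<open>(- 1) ^ card B\<close>
  times the alternating sum for the family \<open>\<psi>\<close>.  If \<open>a\<close> and \<open>b\<close> are separated by a single wall
  and \<open>A\<close> is the set of indices on the open side of \<open>a\<close>, then
  \<open>w(\<psi>, a, B) = w(\<psi>, b, B) - w(flip A \<psi>, b, sym_diff B A)\<close> (\<open>wall_crossing_formula\<close>).  Flipping along a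
  crossed wall preserves salience, so the formula can be iterated along a path; this produces one
  term \<open>w(flip (A K) \<phi>, p, sym_diff B (A K))\<close> with sign \<open>(- 1) ^ length K\<close> for each \<open>K\<close>
  (\<open>path_expansion\<close>).  At the end point \<open>p = (\<Sum>i. x i *\<^sub>R \<phi> i)\<close> with \<open>x \<in> Q_neg N B\<close> the
  coefficients of \<open>p\<close> in the family \<open>flip (A K) \<phi>\<close> have sign pattern \<open>sym_diff B (A K)\<close>, so by the first
  two items only the \<open>K\<close> with \<open>A K = B\<close> contribute.
\<close>

section \<open>Alternating sums over sets of indices\<close>

definition signed_count :: "nat set \<Rightarrow> (nat set \<Rightarrow> bool) \<Rightarrow> nat set \<Rightarrow> int" where
  "signed_count S p B = (\<Sum>I\<in>Pow S. of_bool (B \<subseteq> I \<and> p I) * (- 1) ^ card I)"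

text \<open>
  Adding or removing \<open>k\<close> pairs the subsets of \<open>U\<close>, and the two members of a pair have
  opposite signs.
\<close>

lemma alternating_sum_toggle:
  fixes q :: "nat set \<Rightarrow> int"
  assumes "finite U" "k \<in> U" and q: "\<And>I. I \<subseteq> U - {k} \<Longrightarrow> q (insert k I) = q I"
  shows "(\<Sum>I\<in>Pow U. q I * (- 1) ^ card I) = 0"
proof -
  define V where "V = U - {k}"
  have U: "U = insert k V" "k \<notin> V" "finite V" using assms(1,2) by (auto simp: V_def)
  have inj: "inj_on (insert k) (Pow V)" using U(2) by (force simp: inj_on_def)
  have "(\<Sum>I\<in>Pow U. q I * (- 1) ^ card I)
      = (\<Sum>I\<in>Pow V. q I * (- 1) ^ card I) + (\<Sum>I\<in>insert k ` Pow V. q I * (- 1) ^ card I)"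
    unfolding U(1) Pow_insert using U(2,3) by (subst sum.union_disjoint) auto
  also have "(\<Sum>I\<in>insert k ` Pow V. q I * (- 1) ^ card I)
      = (\<Sum>I\<in>Pow V. q (insert k I) * (- 1) ^ card (insert k I))"
    using inj by (subst sum.reindex) auto
  also have "\<dots> = (\<Sum>I\<in>Pow V. - (q I * (- 1) ^ card I))"
  proof (rule sum.cong[OF refl])
    fix I assume I: "I \<in> Pow V"
    then have "finite I" "k \<notin> I" using U finite_subset by auto
    moreover have "q (insert k I) = q I" using q I by (auto simp: V_def)
    ultimately show "q (insert k I) * (- 1) ^ card (insert k I) = - (q I * (- 1) ^ card I)"
      by simp
  qed
  finally show ?thesis by (simp add: sum_negf)
qed

text \<open>
  The condition on \<open>I\<close> does not see the elements of \<open>V - Y\<close>, so each of them cancels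
  the sum unless \<open>B\<close> forces it into \<open>I\<close>; and \<open>B\<close> must avoid \<open>Y\<close>.  The factor
  \<open>(- 1) ^ card B\<close> compensates the sign of the elements of \<open>V\<close> that are forced into \<open>I\<close>.
\<close>

lemma signed_sum_split:
  fixes U V B Y :: "nat set" and R :: "nat set \<Rightarrow> bool"
  assumes fin: "finite U" "finite V" and dis: "U \<inter> V = {}" and B: "B \<subseteq> U \<union> V" and Y: "Y \<subseteq> V"
  shows "(- 1) ^ card B * signed_count (U \<union> V) (\<lambda>I. I \<inter> Y = {} \<and> R (I \<inter> U)) B
    = of_bool (B \<inter> V = V - Y) * ((- 1) ^ card (B \<inter> U) * signed_count U R (B \<inter> U))"
proof -
  consider (meet) "B \<inter> Y \<noteq> {}" | (free) k where "B \<inter> Y = {}" "k \<in> V - Y" "k \<notin> B"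
    | (full) "B \<inter> V = V - Y" using Y by blast
  then show ?thesis
  proof cases
    case meet
    then have "signed_count (U \<union> V) (\<lambda>I. I \<inter> Y = {} \<and> R (I \<inter> U)) B = 0"
      unfolding signed_count_def by (intro sum.neutral) auto
    then show ?thesis using meet Y by auto
  next
    case free
    have "signed_count (U \<union> V) (\<lambda>I. I \<inter> Y = {} \<and> R (I \<inter> U)) B = 0"
      unfolding signed_count_def
    proof (rule alternating_sum_toggle)
      fix I assume "I \<subseteq> U \<union> V - {k}"
      have "insert k I \<inter> U = I \<inter> U" using free dis by auto
      then show "of_bool (B \<subseteq> insert k I \<and> insert k I \<inter> Y = {} \<and> R (insert k I \<inter> U))
          = (of_bool (B \<subseteq> I \<and> I \<inter> Y = {} \<and> R (I \<inter> U)) :: int)"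
        using free by auto
    qed (use fin free in auto)
    then show ?thesis using free by auto
  next
    case full
    define W where "W = V - Y"
    have W: "finite W" "W \<inter> U = {}" "W \<subseteq> V" "B = (B \<inter> U) \<union> W"
      using fin dis B full by (auto simp: W_def)
    have inj: "inj_on (\<lambda>I. I \<union> W) (Pow U)" using W(2) by (auto simp: inj_on_def)
    have "signed_count (U \<union> V) (\<lambda>I. I \<inter> Y = {} \<and> R (I \<inter> U)) B
      = (\<Sum>I\<in>(\<lambda>I. I \<union> W) ` Pow U.
          of_bool (B \<subseteq> I \<and> I \<inter> Y = {} \<and> R (I \<inter> U)) * (- 1) ^ card I)"
      unfolding signed_count_def
    proof (rule sum.mono_neutral_right)
      show "\<forall>I\<in>Pow (U \<union> V) - (\<lambda>I. I \<union> W) ` Pow U.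
          of_bool (B \<subseteq> I \<and> I \<inter> Y = {} \<and> R (I \<inter> U)) * (- 1) ^ card I = (0::int)"
      proof
        fix I assume I: "I \<in> Pow (U \<union> V) - (\<lambda>I. I \<union> W) ` Pow U"
        have "\<not> (B \<subseteq> I \<and> I \<inter> Y = {})"
        proof
          assume "B \<subseteq> I \<and> I \<inter> Y = {}"
          then have "I = (I \<inter> U) \<union> W" using I W(4) by (auto simp: W_def)
          then show False using I by blast
        qed
        then show "of_bool (B \<subseteq> I \<and> I \<inter> Y = {} \<and> R (I \<inter> U)) * (- 1) ^ card I = (0::int)" by auto
      qed
    qed (use fin W in auto)
    also have "\<dots> = (\<Sum>I\<in>Pow U. of_bool (B \<inter> U \<subseteq> I \<and> R I) * (- 1) ^ card I * (- 1) ^ card W)"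
      unfolding sum.reindex[OF inj] o_def
    proof (rule sum.cong[OF refl])
      fix I assume "I \<in> Pow U"
      then have I: "I \<subseteq> U" by simp
      have "(I \<union> W) \<inter> U = I" "(I \<union> W) \<inter> Y = {}" "B \<subseteq> I \<union> W \<longleftrightarrow> B \<inter> U \<subseteq> I"
        using I W dis Y by (auto simp: W_def)
      moreover have "card (I \<union> W) = card I + card W"
        using I W fin by (intro card_Un_disjoint) (auto dest: finite_subset)
      ultimately show "of_bool (B \<subseteq> I \<union> W \<and> (I \<union> W) \<inter> Y = {} \<and> R ((I \<union> W) \<inter> U)) * (- 1) ^ card (I \<union> W)
          = (of_bool (B \<inter> U \<subseteq> I \<and> R I) * (- 1) ^ card I * (- 1) ^ card W :: int)"
        by (simp add: power_add)
    qed
    also have "\<dots> = signed_count U R (B \<inter> U) * (- 1) ^ card W"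
      by (simp add: signed_count_def sum_distrib_right)
    finally have *: "signed_count (U \<union> V) (\<lambda>I. I \<inter> Y = {} \<and> R (I \<inter> U)) B
      = signed_count U R (B \<inter> U) * (- 1) ^ card W" .
    have "card B = card (B \<inter> U) + card W"
      using W fin by (subst W(4), intro card_Un_disjoint) auto
    then have "(- 1) ^ card B * (- 1) ^ card W = ((- 1) ^ card (B \<inter> U) :: int)"
      by (simp add: power_add flip: power_mult_distrib)
    then show ?thesis using * full by (simp add: mult.assoc mult.commute mult.left_commute)
  qed
qed

text \<open>
  The combinatorial content of wall crossing.  Here \<open>U\<close> stands for the indices of the
  vectors on the wall and \<open>Vp\<close>, \<open>Vm\<close> for those on its open sides.  The difference of the
  indicators of \<open>Pa\<close> and \<open>Pb\<close> is \<open>R (I \<inter> U)\<close> times \<open>[I \<inter> Vm = {}] - [I \<inter> Vp = {}]\<close>, and the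
  indicator of \<open>Pc\<close> is \<open>R (I \<inter> U)\<close> times \<open>1 - [I \<inter> (Vp \<union> Vm) = {}]\<close>.  By \<open>signed_sum_split\<close> each of
  these four terms is an indicator of \<open>B \<inter> (Vp \<union> Vm)\<close> times a common factor, and replacing \<open>B\<close>
  by \<open>sym_diff B Vp\<close> exchanges them suitably.
\<close>

lemma signed_count_crossing:
  fixes U Vp Vm B :: "nat set"
  assumes fin: "finite U" "finite Vp" "finite Vm"
    and dis: "U \<inter> Vp = {}" "U \<inter> Vm = {}" "Vp \<inter> Vm = {}"
    and B: "B \<subseteq> U \<union> Vp \<union> Vm"
    and a: "\<And>I. I \<subseteq> U \<union> Vp \<union> Vm \<Longrightarrow>
      Pa I \<and> \<not> Pb I \<longleftrightarrow> R (I \<inter> U) \<and> I \<inter> Vp \<noteq> {} \<and> I \<inter> Vm = {}"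
    and b: "\<And>I. I \<subseteq> U \<union> Vp \<union> Vm \<Longrightarrow>
      Pb I \<and> \<not> Pa I \<longleftrightarrow> R (I \<inter> U) \<and> I \<inter> Vm \<noteq> {} \<and> I \<inter> Vp = {}"
    and c: "\<And>I. I \<subseteq> U \<union> Vp \<union> Vm \<Longrightarrow> Pc I \<longleftrightarrow> R (I \<inter> U) \<and> I \<inter> (Vp \<union> Vm) \<noteq> {}"
  shows "(- 1) ^ card B * signed_count (U \<union> Vp \<union> Vm) Pa B
    = (- 1) ^ card B * signed_count (U \<union> Vp \<union> Vm) Pb B
      - (- 1) ^ card (sym_diff B Vp) * signed_count (U \<union> Vp \<union> Vm) Pc (sym_diff B Vp)"
proof -
  let ?S = "U \<union> Vp \<union> Vm"
  define H where "H C Y = (- 1) ^ card C * signed_count ?S (\<lambda>I. I \<inter> Y = {} \<and> R (I \<inter> U)) C" for C Y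
  define Z where "Z = (- 1) ^ card (B \<inter> U) * signed_count U R (B \<inter> U)"
  have H: "H C Y = of_bool (C \<inter> (Vp \<union> Vm) = (Vp \<union> Vm) - Y) * Z"
    if "C \<subseteq> ?S" "Y \<subseteq> Vp \<union> Vm" "C \<inter> U = B \<inter> U" for C Y
  proof -
    have "U \<inter> (Vp \<union> Vm) = {}" using dis by blast
    then show ?thesis using signed_sum_split[of U "Vp \<union> Vm" C Y R] that fin
      by (simp add: H_def Z_def Un_assoc)
  qed
  have "signed_count ?S Pa B - signed_count ?S Pb B
      = signed_count ?S (\<lambda>I. I \<inter> Vm = {} \<and> R (I \<inter> U)) B
        - signed_count ?S (\<lambda>I. I \<inter> Vp = {} \<and> R (I \<inter> U)) B"
    unfolding signed_count_def sum_subtractf[symmetric]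
  proof (rule sum.cong[OF refl])
    fix I assume "I \<in> Pow ?S"
    then have I: "I \<subseteq> ?S" by simp
    show "of_bool (B \<subseteq> I \<and> Pa I) * (- 1) ^ card I - of_bool (B \<subseteq> I \<and> Pb I) * (- 1) ^ card I
      = (of_bool (B \<subseteq> I \<and> I \<inter> Vm = {} \<and> R (I \<inter> U)) * (- 1) ^ card I
        - of_bool (B \<subseteq> I \<and> I \<inter> Vp = {} \<and> R (I \<inter> U)) * (- 1) ^ card I :: int)"
      using a[OF I] b[OF I] by (cases "Pa I"; cases "Pb I"; cases "R (I \<inter> U)") auto
  qed
  then have 1: "(- 1) ^ card B * signed_count ?S Pa B - (- 1) ^ card B * signed_count ?S Pb B
      = H B Vm - H B Vp"
    by (simp add: H_def flip: right_diff_distrib)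
  have "signed_count ?S Pc C
      = signed_count ?S (\<lambda>I. I \<inter> {} = {} \<and> R (I \<inter> U)) C
        - signed_count ?S (\<lambda>I. I \<inter> (Vp \<union> Vm) = {} \<and> R (I \<inter> U)) C" for C
    unfolding signed_count_def sum_subtractf[symmetric]
    using c by (intro sum.cong[OF refl]) auto
  then have 2: "(- 1) ^ card C * signed_count ?S Pc C = H C {} - H C (Vp \<union> Vm)" for C
    by (simp add: H_def flip: right_diff_distrib)
  have "H B Vm = of_bool (B \<inter> (Vp \<union> Vm) = Vp) * Z"
    using B dis by (subst H) (auto intro!: arg_cong[of _ _ of_bool])
  moreover have "H B Vp = of_bool (B \<inter> (Vp \<union> Vm) = Vm) * Z"
    using B dis by (subst H) (auto intro!: arg_cong[of _ _ of_bool])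
  moreover have "H (sym_diff B Vp) {} = of_bool (B \<inter> (Vp \<union> Vm) = Vm) * Z"
  proof -
    have "sym_diff B Vp \<inter> (Vp \<union> Vm) = (Vp \<union> Vm) - {} \<longleftrightarrow> B \<inter> (Vp \<union> Vm) = Vm" using dis by blast
    moreover have "sym_diff B Vp \<subseteq> ?S" "sym_diff B Vp \<inter> U = B \<inter> U" using B dis by blast+
    ultimately show ?thesis by (subst H) auto
  qed
  moreover have "H (sym_diff B Vp) (Vp \<union> Vm) = of_bool (B \<inter> (Vp \<union> Vm) = Vp) * Z"
  proof -
    have "sym_diff B Vp \<inter> (Vp \<union> Vm) = (Vp \<union> Vm) - (Vp \<union> Vm) \<longleftrightarrow> B \<inter> (Vp \<union> Vm) = Vp"
      using dis by blast
    moreover have "sym_diff B Vp \<subseteq> ?S" "sym_diff B Vp \<inter> U = B \<inter> U" using B dis by blast+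
    ultimately show ?thesis by (subst H) auto
  qed
  ultimately show ?thesis using 1 2[of "sym_diff B Vp"] by linarith
qed

section \<open>Bases in general position\<close>

lemma gen_coneI: "\<lbrakk>\<And>i. i \<in> I \<Longrightarrow> t i \<ge> 0; x = (\<Sum>i\<in>I. t i *\<^sub>R \<psi> i)\<rbrakk> \<Longrightarrow> x \<in> gen_cone \<psi> I"
  unfolding gen_cone_def by blast

lemma gen_cone_mono:
  assumes "J \<subseteq> I" "finite I" shows "gen_cone \<psi> J \<subseteq> gen_cone \<psi> I"
proof
  fix x assume "x \<in> gen_cone \<psi> J"
  then obtain t where t: "\<And>i. i \<in> J \<Longrightarrow> t i \<ge> 0" "x = (\<Sum>i\<in>J. t i *\<^sub>R \<psi> i)"
    unfolding gen_cone_def by blast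
  have "(\<Sum>i\<in>J. t i *\<^sub>R \<psi> i) = (\<Sum>i\<in>I. (if i \<in> J then t i else 0) *\<^sub>R \<psi> i)"
    using assms by (intro sum.mono_neutral_cong_left) auto
  then show "x \<in> gen_cone \<psi> I"
    using t by (intro gen_coneI[of I "\<lambda>i. if i \<in> J then t i else 0"]) auto
qed

lemma gen_cone_subset_span: "gen_cone \<psi> I \<subseteq> span (\<psi> ` I)"
  unfolding gen_cone_def by (auto intro!: span_sum span_scale intro: span_base)

lemma span_image_sum:
  assumes "finite K" "x \<in> span (\<psi> ` K)"
  obtains u where "x = (\<Sum>i\<in>K. u i *\<^sub>R \<psi> i)"
proof -
  have "\<exists>u. x = (\<Sum>i\<in>K. u i *\<^sub>R \<psi> i)" if "x \<in> span (\<psi> ` K)" for x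
    using assms(1) that
  proof (induction K arbitrary: x rule: finite_induct)
    case (insert k K)
    then obtain c where "x - c *\<^sub>R \<psi> k \<in> span (\<psi> ` K)" by (auto simp: span_insert)
    then obtain u where u: "x - c *\<^sub>R \<psi> k = (\<Sum>i\<in>K. u i *\<^sub>R \<psi> i)" using insert.IH by blast
    have "(\<Sum>i\<in>insert k K. (u(k := c)) i *\<^sub>R \<psi> i) = c *\<^sub>R \<psi> k + (\<Sum>i\<in>K. u i *\<^sub>R \<psi> i)"
      using insert.hyps by (auto intro!: sum.cong)
    then show ?case using u by (metis add.commute diff_add_cancel)
  qed auto
  then show ?thesis using that assms(2) by blast
qed

definition basis_indices :: "'a::euclidean_space set \<Rightarrow> (nat \<Rightarrow> 'a) \<Rightarrow> nat set \<Rightarrow> bool" where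
  "basis_indices F \<psi> J \<longleftrightarrow> finite J \<and> inj_on \<psi> J \<and> independent (\<psi> ` J) \<and> span (\<psi> ` J) = F"

lemma spanning_basis_indices:
  assumes "finite J" "span (\<psi> ` J) = F" "card J \<le> dim F"
  shows "basis_indices F \<psi> J"
proof -
  have d: "dim F = dim (\<psi> ` J)" using assms(2) by (metis dim_span)
  have le: "dim (\<psi> ` J) \<le> card (\<psi> ` J)" using assms(1) by (simp add: dim_le_card')
  have "card (\<psi> ` J) \<le> card J" using assms(1) by (rule card_image_le)
  then have eq: "card (\<psi> ` J) = card J" "card (\<psi> ` J) = dim (\<psi> ` J)" using d le assms(3) by auto
  have "independent (\<psi> ` J)"
    using card_le_dim_spanning[of "\<psi> ` J" "span (\<psi> ` J)"] assms(1) eq(2)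
    by (simp add: span_superset)
  then show ?thesis using assms eq eq_card_imp_inj_on by (auto simp: basis_indices_def)
qed

lemma basis_indices_functional:
  assumes "basis_indices F \<psi> J"
  obtains g :: "'a::euclidean_space \<Rightarrow> real" where "linear g" "\<And>j. j \<in> J \<Longrightarrow> g (\<psi> j) = c j"
proof -
  have "independent (\<psi> ` J)" "inj_on \<psi> J" using assms by (auto simp: basis_indices_def)
  then obtain g :: "'a \<Rightarrow> real" where "linear g" "\<forall>x\<in>\<psi> ` J. g x = (c \<circ> inv_into J \<psi>) x"
    using linear_independent_extend by blast
  then show ?thesis using that \<open>inj_on \<psi> J\<close> by (auto simp: inv_into_f_f)
qed

text \<open>
  The dual basis, as functionals on the whole ambient space.
\<close>

lemma basis_indices_coordinates:
  fixes \<psi> :: "nat \<Rightarrow> 'a::euclidean_space"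
  assumes J: "basis_indices F \<psi> J"
  shows "\<exists>f :: nat \<Rightarrow> 'a \<Rightarrow> real. (\<forall>i. linear (f i)) \<and>
    (\<forall>i. \<forall>j\<in>J. f i (\<psi> j) = of_bool (i = j)) \<and> (\<forall>x\<in>F. x = (\<Sum>j\<in>J. f j x *\<^sub>R \<psi> j))"
proof -
  have "\<exists>g :: 'a \<Rightarrow> real. linear g \<and> (\<forall>j\<in>J. g (\<psi> j) = of_bool (i = j))" for i
    by (rule basis_indices_functional[OF J, of "\<lambda>j. of_bool (i = j)"]) blast
  then have "\<exists>f :: nat \<Rightarrow> 'a \<Rightarrow> real. \<forall>i. linear (f i) \<and> (\<forall>j\<in>J. f i (\<psi> j) = of_bool (i = j))"
    by (intro choice) blast
  then obtain f :: "nat \<Rightarrow> 'a \<Rightarrow> real" where f: "\<And>i. linear (f i)"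
    "\<And>i j. j \<in> J \<Longrightarrow> f i (\<psi> j) = of_bool (i = j)" by blast
  have "x = (\<Sum>j\<in>J. f j x *\<^sub>R \<psi> j)" if "x \<in> F" for x
  proof -
    have "finite J" "x \<in> span (\<psi> ` J)" using J that by (auto simp: basis_indices_def)
    then obtain u where u: "x = (\<Sum>i\<in>J. u i *\<^sub>R \<psi> i)" using span_image_sum by blast
    have "f j x = u j" if "j \<in> J" for j
      unfolding u using f(2) that \<open>finite J\<close>
      by (simp add: linear_sum[OF f(1)] linear_scale[OF f(1)] of_bool_def if_distrib[of "\<lambda>c. _ * c"] cong: if_cong)
    then have "(\<Sum>j\<in>J. f j x *\<^sub>R \<psi> j) = (\<Sum>j\<in>J. u j *\<^sub>R \<psi> j)" by simp
    then show ?thesis using u by simp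
  qed
  then show ?thesis using f by blast
qed

definition general_position ::
    "'a::euclidean_space set \<Rightarrow> (nat \<Rightarrow> 'a) \<Rightarrow> nat set \<Rightarrow> 'a \<Rightarrow> bool" where
  "general_position F \<psi> S a \<longleftrightarrow>
     a \<in> F \<and> (\<forall>K\<subseteq>S. a \<in> span (\<psi> ` K) \<longrightarrow> span (\<psi> ` K) = F)"

lemma general_position_span:
  "\<lbrakk>general_position F \<psi> S a; K \<subseteq> S; a \<in> span (\<psi> ` K)\<rbrakk> \<Longrightarrow> span (\<psi> ` K) = F"
  unfolding general_position_def by blast

lemma general_position_card:
  fixes \<psi> :: "nat \<Rightarrow> 'a::euclidean_space"
  assumes "general_position F \<psi> S a" "K \<subseteq> S" "finite K" "a \<in> span (\<psi> ` K)"
  shows "dim F \<le> card K"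
proof -
  have "dim F = dim (\<psi> ` K)" using general_position_span[OF assms(1,2,4)] by (metis dim_span)
  also have "\<dots> \<le> card (\<psi> ` K)" using assms(3) by (simp add: dim_le_card')
  also have "\<dots> \<le> card K" using assms(3) by (rule card_image_le)
  finally show ?thesis .
qed

text \<open>
  Nondegeneracy: a point in general position is not spanned by fewer than \<open>dim F\<close>
  vectors, so none of its coordinates with respect to a basis vanishes.
\<close>

lemma general_position_nonzero:
  fixes \<psi> :: "nat \<Rightarrow> 'a::euclidean_space"
  assumes "general_position F \<psi> S a" "J \<subseteq> S" "finite J" "card J \<le> dim F"
    and y: "a = (\<Sum>i\<in>J. y i *\<^sub>R \<psi> i)" and j: "j \<in> J"
  shows "y j \<noteq> 0"
proof
  assume "y j = 0"
  then have "a = (\<Sum>i\<in>J - {j}. y i *\<^sub>R \<psi> i)" using y j assms(3) by (simp add: sum.remove[of J j])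
  then have "a \<in> span (\<psi> ` (J - {j}))" by (auto intro!: span_sum span_scale intro: span_base)
  then have "dim F \<le> card (J - {j})" using assms by (intro general_position_card[OF assms(1)]) auto
  then show False using assms(3,4) j by (metis card_Diff1_less not_le order.strict_trans2)
qed

text \<open>
  The ratio test of the simplex algorithm: moving from \<open>t\<close> in the direction \<open>- u\<close>, the first
  coordinate \<open>k\<close> to vanish determines the length \<open>s\<close> of the step.
\<close>

lemma ratio_test:
  fixes t u :: "nat \<Rightarrow> real"
  assumes "finite K" "\<And>i. i \<in> K \<Longrightarrow> t i \<ge> 0" "i0 \<in> K" "u i0 > 0"
  obtains s k where "k \<in> K" "u k > 0" "s \<ge> 0" "\<And>i. i \<in> K \<Longrightarrow> t i - s * u i \<ge> 0"
    "t k - s * u k = 0"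
proof -
  define M where "M = {i \<in> K. u i > 0}"
  have M: "finite M" "M \<noteq> {}" using assms by (auto simp: M_def)
  define k where "k = arg_min_on (\<lambda>i. t i / u i) M"
  have k: "k \<in> M" "\<And>i. i \<in> M \<Longrightarrow> t k / u k \<le> t i / u i"
    using arg_min_if_finite(1)[OF M] arg_min_least[OF M] by (auto simp: k_def)
  show ?thesis
  proof (rule that[of k "t k / u k"])
    show s: "t k / u k \<ge> 0" using k(1) assms(2) by (auto simp: M_def)
    fix i assume i: "i \<in> K"
    show "t i - t k / u k * u i \<ge> 0"
    proof (cases "u i > 0")
      case True
      then have "t k / u k \<le> t i / u i" using k(2) i by (auto simp: M_def)
      then show ?thesis using True by (simp add: pos_le_divide_eq)
    next
      case False
      then have "t k / u k * u i \<le> 0" using s by (intro mult_nonneg_nonpos) auto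
      then show ?thesis using assms(2)[OF i] by linarith
    qed
  qed (use k(1) in \<open>auto simp: M_def\<close>)
qed

lemma linear_relation_if_card:
  fixes \<psi> :: "nat \<Rightarrow> 'a::euclidean_space"
  assumes K: "finite K" "\<psi> ` K \<subseteq> F" "card K > dim F"
  obtains u k where "k \<in> K" "u k > (0::real)" "(\<Sum>i\<in>K. u i *\<^sub>R \<psi> i) = 0"
proof -
  have "\<exists>u. (\<exists>k\<in>K. u k \<noteq> 0) \<and> (\<Sum>i\<in>K. u i *\<^sub>R \<psi> i) = 0"
  proof (cases "inj_on \<psi> K")
    case True
    have "dependent (\<psi> ` K)"
    proof (rule ccontr)
      assume "\<not> dependent (\<psi> ` K)"
      then have "card (\<psi> ` K) \<le> dim F" using K(2) by (intro independent_card_le_dim)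
      then show False using K(3) True by (simp add: card_image)
    qed
    then obtain u where "\<exists>v\<in>\<psi> ` K. u v \<noteq> 0" "(\<Sum>v\<in>\<psi> ` K. u v *\<^sub>R v) = 0"
      using dependent_finite[of "\<psi> ` K"] K(1) by auto
    then show ?thesis using True by (intro exI[of _ "u \<circ> \<psi>"]) (auto simp: sum.reindex)
  next
    case False
    then obtain i j where ij: "i \<in> K" "j \<in> K" "i \<noteq> j" "\<psi> i = \<psi> j" by (auto simp: inj_on_def)
    have "(\<Sum>l\<in>K. (of_bool (l = i) - of_bool (l = j) :: real) *\<^sub>R \<psi> l) = 0"
      using ij K(1) by (simp add: scaleR_left_diff_distrib sum_subtractf of_bool_def if_distrib[of "\<lambda>c. c *\<^sub>R _"] cong: if_cong)
    then show ?thesis using ij by (intro exI[of _ "\<lambda>l. of_bool (l = i) - of_bool (l = j)"]) auto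
  qed
  then obtain u k where u: "k \<in> K" "u k \<noteq> 0" "(\<Sum>i\<in>K. u i *\<^sub>R \<psi> i) = 0" by blast
  show ?thesis
  proof (cases "u k > 0")
    case True
    then show ?thesis using that u by blast
  next
    case False
    then show ?thesis using that[of k "\<lambda>i. - u i"] u by (simp add: sum_negf)
  qed
qed

text \<open>
  Caratheodory's theorem, where general position turns the upper bound \<open>dim F\<close> on the number
  of vectors into an equality.  In a subset of \<open>I\<close> of minimal size there is no relation to
  move along, since the ratio test would make it smaller.
\<close>

lemma caratheodory_general_position:
  fixes \<psi> :: "nat \<Rightarrow> 'a::euclidean_space"
  assumes S: "finite S" "\<psi> ` S \<subseteq> F" and gp: "general_position F \<psi> S a"
    and I: "I \<subseteq> S" "a \<in> gen_cone \<psi> I"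
  obtains J where "J \<subseteq> I" "card J = dim F" "a \<in> gen_cone \<psi> J"
proof -
  define K where "K = arg_min_on card {K. K \<subseteq> I \<and> a \<in> gen_cone \<psi> K}"
  have fin: "finite I" using I(1) S(1) by (rule finite_subset)
  then have f: "finite {K. K \<subseteq> I \<and> a \<in> gen_cone \<psi> K}" by simp
  have n: "{K. K \<subseteq> I \<and> a \<in> gen_cone \<psi> K} \<noteq> {}" using I(2) by blast
  have K: "K \<subseteq> I" "a \<in> gen_cone \<psi> K" using arg_min_if_finite(1)[OF f n, of card] by (auto simp: K_def)
  have min: "card K \<le> card L" if "L \<subseteq> I" "a \<in> gen_cone \<psi> L" for L
    using arg_min_least[OF f n, of L card] that by (auto simp: K_def)
  have finK: "finite K" using K(1) fin by (rule finite_subset)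
  have "card K \<le> dim F"
  proof (rule ccontr)
    assume "\<not> card K \<le> dim F"
    then obtain u i0 where u: "i0 \<in> K" "u i0 > 0" "(\<Sum>i\<in>K. u i *\<^sub>R \<psi> i) = 0"
      using linear_relation_if_card[of K \<psi> F] finK K(1) I(1) S(2) by (metis image_mono not_le order_trans)
    obtain t where t: "\<And>i. i \<in> K \<Longrightarrow> t i \<ge> 0" "a = (\<Sum>i\<in>K. t i *\<^sub>R \<psi> i)"
      using K(2) unfolding gen_cone_def by blast
    obtain s k where s: "k \<in> K" "\<And>i. i \<in> K \<Longrightarrow> t i - s * u i \<ge> 0" "t k - s * u k = 0"
      using ratio_test[of K t i0 u, OF finK t(1) u(1,2)] by metis
    have "a = (\<Sum>i\<in>K. t i *\<^sub>R \<psi> i) - s *\<^sub>R (\<Sum>i\<in>K. u i *\<^sub>R \<psi> i)" using t(2) u(3) by simp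
    also have "\<dots> = (\<Sum>i\<in>K. (t i - s * u i) *\<^sub>R \<psi> i)"
      by (simp add: scaleR_sum_right scaleR_left_diff_distrib sum_subtractf)
    also have "\<dots> = (\<Sum>i\<in>K - {k}. (t i - s * u i) *\<^sub>R \<psi> i)"
      using s(1,3) finK by (simp add: sum.remove[of K k])
    finally have "a \<in> gen_cone \<psi> (K - {k})" using s(2) by (intro gen_coneI[of _ "\<lambda>i. t i - s * u i"]) auto
    then have "card K \<le> card (K - {k})" using K(1) by (intro min) auto
    then show False using s(1) finK by (metis card_Diff1_less not_le)
  qed
  moreover have "dim F \<le> card K"
    using K I(1) finK gen_cone_subset_span[of \<psi> K] by (intro general_position_card[OF gp]) auto
  ultimately show ?thesis using that K by simp
qed

section \<open>Alternating sums over the faces of a simple polytope\<close>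

text \<open>
  For nonzero vectors this is equivalent to salience of the generated cone; it is the form in
  which salience is used.
\<close>

definition positively_independent :: "(nat \<Rightarrow> 'a::real_vector) \<Rightarrow> nat set \<Rightarrow> bool" where
  "positively_independent \<psi> S \<longleftrightarrow>
     (\<forall>t. (\<forall>i\<in>S. t i \<ge> 0) \<and> (\<Sum>i\<in>S. t i *\<^sub>R \<psi> i) = 0 \<longrightarrow> (\<forall>i\<in>S. t i = 0))"

text \<open>
  For \<open>a\<close> in general position these are the vertices of the polytope of all \<open>y \<ge> 0\<close> with
  \<open>(\<Sum>i\<in>S. y i *\<^sub>R \<psi> i) = a\<close>, a vertex being encoded by its support.
\<close>

definition vertex_bases ::
    "'a::euclidean_space set \<Rightarrow> (nat \<Rightarrow> 'a) \<Rightarrow> nat set \<Rightarrow> 'a \<Rightarrow> nat set set" where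
  "vertex_bases F \<psi> S a = {J. J \<subseteq> S \<and> card J = dim F \<and> a \<in> gen_cone \<psi> J}"

text \<open>
  For a basis \<open>J\<close>, the functional that reproduces the costs of \<open>J\<close> (the dual solution in linear
  programming): \<open>price \<psi> J c a\<close> is the cost of the vertex \<open>J\<close>, and \<open>c j - price \<psi> J c (\<psi> j)\<close> is the
  reduced cost of \<open>j\<close>.
\<close>

definition price :: "(nat \<Rightarrow> 'a::real_vector) \<Rightarrow> nat set \<Rightarrow> (nat \<Rightarrow> real) \<Rightarrow> 'a \<Rightarrow> real" where
  "price \<psi> J c = (SOME g. linear g \<and> (\<forall>j\<in>J. g (\<psi> j) = c j))"

lemma finite_vertex_bases: "finite S \<Longrightarrow> finite (vertex_bases F \<psi> S a)"
  by (rule finite_subset[of _ "Pow S"]) (auto simp: vertex_bases_def)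

lemma vertex_bases_basis_indices:
  assumes "finite S" "general_position F \<psi> S a" "J \<in> vertex_bases F \<psi> S a"
  shows "basis_indices F \<psi> J"
proof -
  have J: "J \<subseteq> S" "card J = dim F" "a \<in> span (\<psi> ` J)"
    using assms(3) gen_cone_subset_span[of \<psi> J] by (auto simp: vertex_bases_def)
  then show ?thesis
    using assms(1,2) by (intro spanning_basis_indices general_position_span) (auto intro: finite_subset)
qed

lemma price:
  assumes "basis_indices F \<psi> J"
  shows linear_price: "linear (price \<psi> J c)" and price_basis: "\<And>j. j \<in> J \<Longrightarrow> price \<psi> J c (\<psi> j) = c j"
proof -
  have "\<exists>g. linear g \<and> (\<forall>j\<in>J. g (\<psi> j) = c j)"
    by (rule basis_indices_functional[OF assms, of c]) blast
  then have "linear (price \<psi> J c) \<and> (\<forall>j\<in>J. price \<psi> J c (\<psi> j) = c j)"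
    unfolding price_def by (rule someI_ex)
  then show "linear (price \<psi> J c)" "\<And>j. j \<in> J \<Longrightarrow> price \<psi> J c (\<psi> j) = c j" by auto
qed

lemma price_sum:
  assumes "basis_indices F \<psi> J"
  shows "price \<psi> J c (\<Sum>i\<in>K. y i *\<^sub>R \<psi> i) = (\<Sum>i\<in>K. y i * price \<psi> J c (\<psi> i))"
  using linear_price[OF assms] by (simp add: linear_sum linear_scale)

lemma price_sum_basis:
  assumes "basis_indices F \<psi> J"
  shows "price \<psi> J c (\<Sum>i\<in>J. y i *\<^sub>R \<psi> i) = (\<Sum>i\<in>J. y i * c i)"
  by (simp add: price_sum[OF assms] price_basis[OF assms])

text \<open>
  Finitely many hyperplanes can be avoided by an arbitrarily small perturbation, which does not
  disturb finitely many strict inequalities.  One hyperplane \<open>\<gamma>\<close> is avoided at a time, by moving a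
  coordinate that occurs in \<open>\<gamma>\<close>.
\<close>

lemma generic_perturbation:
  fixes c0 :: "nat \<Rightarrow> real" and E D :: "(nat \<Rightarrow> real) set"
  assumes "finite S" "finite E" "finite D"
    and "\<And>\<beta>. \<beta> \<in> E \<Longrightarrow> (\<Sum>i\<in>S. \<beta> i * c0 i) > 0"
    and "\<And>\<gamma>. \<gamma> \<in> D \<Longrightarrow> \<exists>i\<in>S. \<gamma> i \<noteq> 0"
  obtains c where "\<And>\<beta>. \<beta> \<in> E \<Longrightarrow> (\<Sum>i\<in>S. \<beta> i * c i) > 0"
    and "\<And>\<gamma>. \<gamma> \<in> D \<Longrightarrow> (\<Sum>i\<in>S. \<gamma> i * c i) \<noteq> 0"
proof -
  have "\<exists>c. (\<forall>\<beta>\<in>E. (\<Sum>i\<in>S. \<beta> i * c i) > 0) \<and> (\<forall>\<gamma>\<in>D. (\<Sum>i\<in>S. \<gamma> i * c i) \<noteq> 0)"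
    using assms(3,5)
  proof (induction D rule: finite_induct)
    case empty
    then show ?case using assms(4) by blast
  next
    case (insert \<gamma> D)
    then obtain c where c: "\<forall>\<beta>\<in>E. (\<Sum>i\<in>S. \<beta> i * c i) > 0" "\<forall>\<gamma>\<in>D. (\<Sum>i\<in>S. \<gamma> i * c i) \<noteq> 0"
      by blast
    obtain k where k: "k \<in> S" "\<gamma> k \<noteq> 0" using insert.prems by blast
    define c' where "c' e = c(k := c k + e)" for e
    have c': "(\<Sum>i\<in>S. \<beta> i * c' e i) = (\<Sum>i\<in>S. \<beta> i * c i) + \<beta> k * e" for \<beta> e
      using k(1) assms(1) by (simp add: c'_def sum.remove[of S k] algebra_simps)
    have lim: "((\<lambda>e. \<Sum>i\<in>S. \<beta> i * c' e i) \<longlongrightarrow> (\<Sum>i\<in>S. \<beta> i * c i)) (at_right 0)" for \<beta>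
      unfolding c' by (auto intro!: tendsto_eq_intros)
    have E: "eventually (\<lambda>e. \<forall>\<beta>\<in>E. (\<Sum>i\<in>S. \<beta> i * c' e i) > 0) (at_right 0)"
      using assms(2) c(1) by (intro eventually_ball_finite ballI order_tendstoD(1)[OF lim]) auto
    have D: "eventually (\<lambda>e. \<forall>\<gamma>\<in>D. (\<Sum>i\<in>S. \<gamma> i * c' e i) \<noteq> 0) (at_right 0)"
      using insert.hyps(1) c(2)
      by (intro eventually_ball_finite ballI tendsto_imp_eventually_ne[OF lim]) auto
    have G: "eventually (\<lambda>e. (\<Sum>i\<in>S. \<gamma> i * c' e i) \<noteq> 0) (at_right 0)"
    proof (cases "(\<Sum>i\<in>S. \<gamma> i * c i) = 0")
      case True
      then show ?thesis
        using k(2) unfolding c' by (auto intro: eventually_mono[OF eventually_at_right_less])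
    next
      case False
      then show ?thesis by (rule tendsto_imp_eventually_ne[OF lim])
    qed
    have "eventually (\<lambda>e. (\<forall>\<beta>\<in>E. (\<Sum>i\<in>S. \<beta> i * c' e i) > 0)
        \<and> (\<forall>\<gamma>\<in>insert \<gamma> D. (\<Sum>i\<in>S. \<gamma> i * c' e i) \<noteq> 0)) (at_right 0)"
      using E D G by eventually_elim auto
    then show ?case using eventually_happens trivial_limit_at_right_real by blast
  qed
  then show ?thesis using that by blast
qed

text \<open>
  On every face of the polytope the cost \<open>c\<close> attains its minimum at exactly one vertex.

  Existence: among the finitely many vertices of the face take one of minimal cost.  If the reduced
  cost of some \<open>j\<close> were negative, the ratio test along the edge of \<open>j\<close> would produce a cheaper vertex;
  the edge is bounded because the family is positively independent, and it has positive length
  because \<open>a\<close> is in general position.  Uniqueness: prices certify optimality, strictly so against a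
  vertex that uses an index outside \<open>J\<close>.
\<close>

lemma ex1_optimal_vertex_basis:
  fixes \<psi> :: "nat \<Rightarrow> 'a::euclidean_space"
  assumes S: "finite S" "\<psi> ` S \<subseteq> F" and gp: "general_position F \<psi> S a"
    and pos: "positively_independent \<psi> S"
    and gen: "\<And>J j. \<lbrakk>J \<in> vertex_bases F \<psi> S a; j \<in> S - J\<rbrakk> \<Longrightarrow> price \<psi> J c (\<psi> j) \<noteq> c j"
    and I: "I \<subseteq> S" "a \<in> gen_cone \<psi> I"
  shows "\<exists>!J. J \<in> vertex_bases F \<psi> S a \<and> J \<subseteq> I \<and> (\<forall>j\<in>I - J. price \<psi> J c (\<psi> j) < c j)"
proof (rule ex_ex1I)
  let ?V = "vertex_bases F \<psi> I a"
  have VS: "J \<in> vertex_bases F \<psi> S a" "J \<subseteq> I" "basis_indices F \<psi> J" if "J \<in> ?V" for J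
    using that I(1) vertex_bases_basis_indices[OF S(1) gp, of J] by (auto simp: vertex_bases_def)
  have fin: "finite I" using I(1) S(1) by (rule finite_subset)
  have "?V \<noteq> {}"
    by (rule caratheodory_general_position[OF S gp I]) (auto simp: vertex_bases_def)
  moreover have "finite ?V" using fin by (rule finite_vertex_bases)
  ultimately obtain J where J: "J \<in> ?V" and min: "\<And>L. L \<in> ?V \<Longrightarrow> price \<psi> J c a \<le> price \<psi> L c a"
    using arg_min_if_finite(1)[of ?V "\<lambda>J. price \<psi> J c a"] arg_min_least[of ?V _ "\<lambda>J. price \<psi> J c a"]
    by blast
  note bas = VS(3)[OF J]
  have "price \<psi> J c (\<psi> j) < c j" if j: "j \<in> I - J" for j
  proof (rule ccontr)
    assume "\<not> price \<psi> J c (\<psi> j) < c j"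
    moreover have "price \<psi> J c (\<psi> j) \<noteq> c j" using gen VS(1)[OF J] j I(1) by blast
    ultimately have gt: "price \<psi> J c (\<psi> j) > c j" by simp
    have finJ: "finite J" and spanJ: "span (\<psi> ` J) = F" using bas by (auto simp: basis_indices_def)
    have "\<psi> j \<in> span (\<psi> ` J)" using j I(1) S(2) spanJ by blast
    then obtain u where u: "\<psi> j = (\<Sum>i\<in>J. u i *\<^sub>R \<psi> i)" using span_image_sum finJ by blast
    obtain y where y: "\<And>i. i \<in> J \<Longrightarrow> y i \<ge> 0" "a = (\<Sum>i\<in>J. y i *\<^sub>R \<psi> i)"
      using J unfolding vertex_bases_def gen_cone_def by blast
    have JS: "J \<subseteq> S" "card J \<le> dim F" "card J = dim F" using J I(1) by (auto simp: vertex_bases_def)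
    have "\<exists>i\<in>J. u i > 0"
    proof (rule ccontr)
      assume neg: "\<not> (\<exists>i\<in>J. u i > 0)"
      define t where "t i = (if i = j then 1 else if i \<in> J then - u i else 0)" for i
      have "(\<Sum>i\<in>S. t i *\<^sub>R \<psi> i) = (\<Sum>i\<in>insert j J. t i *\<^sub>R \<psi> i)"
        using S(1) j JS I(1) by (intro sum.mono_neutral_right) (auto simp: t_def)
      also have "\<dots> = \<psi> j + (\<Sum>i\<in>J. - u i *\<^sub>R \<psi> i)"
        using j finJ by (auto simp: t_def intro!: sum.cong)
      also have "\<dots> = 0" using u by (simp add: sum_negf)
      finally have "(\<Sum>i\<in>S. t i *\<^sub>R \<psi> i) = 0" .
      moreover have "\<forall>i\<in>S. t i \<ge> 0" using neg by (auto simp: t_def not_less)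
      ultimately have "t j = 0" using pos j I(1) unfolding positively_independent_def by blast
      then show False by (simp add: t_def)
    qed
    then obtain i0 where i0: "i0 \<in> J" "u i0 > 0" by blast
    obtain s k where s: "k \<in> J" "u k > 0" "s \<ge> 0"
        "\<And>i. i \<in> J \<Longrightarrow> y i - s * u i \<ge> 0" "y k - s * u k = 0"
      using ratio_test[of J y i0 u, OF finJ y(1) i0] by metis
    have "y k \<noteq> 0" using general_position_nonzero[OF gp JS(1) finJ JS(2) y(2) s(1)] .
    then have "s \<noteq> 0" using s(5) by auto
    then have spos: "s > 0" using s(3) by simp
    \<comment> \<open>pivot: \<open>j\<close> enters the basis, \<open>k\<close> leaves it\<close>
    define L where "L = insert j (J - {k})"
    define z where "z i = (if i = j then s else y i - s * u i)" for i
    have zj: "z j = s" and zJ: "\<And>i. i \<in> J - {k} \<Longrightarrow> z i = y i - s * u i"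
      using j by (auto simp: z_def)
    have zL: "(\<Sum>i\<in>L. z i *\<^sub>R \<psi> i) = a"
    proof -
      have "(\<Sum>i\<in>L. z i *\<^sub>R \<psi> i) = s *\<^sub>R \<psi> j + (\<Sum>i\<in>J - {k}. (y i - s * u i) *\<^sub>R \<psi> i)"
        using finJ j zJ by (simp add: L_def zj)
      also have "(\<Sum>i\<in>J - {k}. (y i - s * u i) *\<^sub>R \<psi> i) = (\<Sum>i\<in>J. (y i - s * u i) *\<^sub>R \<psi> i)"
        using s(1,5) finJ by (simp add: sum.remove[of J k])
      also have "\<dots> = a - s *\<^sub>R \<psi> j"
        by (simp add: y(2) u scaleR_sum_right scaleR_left_diff_distrib sum_subtractf)
      finally show ?thesis by simp
    qed
    have LV: "L \<in> ?V"
    proof -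
      have "card J > 0" using finJ s(1) by (auto simp: card_gt_0_iff)
      then have "card L = card J" using finJ j s(1) by (simp add: L_def)
      moreover have "a \<in> gen_cone \<psi> L"
        using zL s(4) spos by (intro gen_coneI[of _ z]) (auto simp: z_def L_def)
      ultimately show ?thesis using J j by (auto simp: vertex_bases_def L_def)
    qed
    have "price \<psi> L c a = (\<Sum>i\<in>L. z i * c i)"
      using price_sum_basis[OF VS(3)[OF LV], of c z] zL by simp
    also have "\<dots> = s * c j + (\<Sum>i\<in>J - {k}. (y i - s * u i) * c i)"
      using finJ j zJ by (simp add: L_def zj)
    also have "(\<Sum>i\<in>J - {k}. (y i - s * u i) * c i) = (\<Sum>i\<in>J. (y i - s * u i) * c i)"
      using s(1,5) finJ by (simp add: sum.remove[of J k])
    also have "\<dots> = price \<psi> J c a - s * price \<psi> J c (\<psi> j)"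
      unfolding u y(2) price_sum_basis[OF bas]
      by (simp add: left_diff_distrib sum_subtractf sum_distrib_left mult.assoc)
    also have "s * c j + \<dots> < price \<psi> J c a" using gt spos by simp
    finally show False using min[OF LV] by simp
  qed
  then show "\<exists>J. J \<in> vertex_bases F \<psi> S a \<and> J \<subseteq> I \<and> (\<forall>j\<in>I - J. price \<psi> J c (\<psi> j) < c j)"
    using VS[OF J] by blast
next
  fix J L
  assume J: "J \<in> vertex_bases F \<psi> S a \<and> J \<subseteq> I \<and> (\<forall>j\<in>I - J. price \<psi> J c (\<psi> j) < c j)"
    and L: "L \<in> vertex_bases F \<psi> S a \<and> L \<subseteq> I \<and> (\<forall>j\<in>I - L. price \<psi> L c (\<psi> j) < c j)"
  have less: "price \<psi> J c a < price \<psi> L c a"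
    if J: "J \<in> vertex_bases F \<psi> S a" "J \<subseteq> I" "\<forall>j\<in>I - J. price \<psi> J c (\<psi> j) < c j"
      and L: "L \<in> vertex_bases F \<psi> S a" "L \<subseteq> I" and ne: "J \<noteq> L" for J L
  proof -
    have bJ: "basis_indices F \<psi> J" and bL: "basis_indices F \<psi> L"
      using vertex_bases_basis_indices[OF S(1) gp] J L by blast+
    have fin: "finite J" "finite L" using bJ bL by (auto simp: basis_indices_def)
    have card: "L \<subseteq> S" "card L \<le> dim F" "card L = card J" using J L by (auto simp: vertex_bases_def)
    then have "\<not> L \<subseteq> J" using ne fin by (metis card_subset_eq)
    then obtain k where k: "k \<in> L" "k \<notin> J" by blast
    obtain y where y: "\<And>i. i \<in> L \<Longrightarrow> y i \<ge> 0" "a = (\<Sum>i\<in>L. y i *\<^sub>R \<psi> i)"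
      using L unfolding vertex_bases_def gen_cone_def by blast
    have "y k \<noteq> 0" using general_position_nonzero[OF gp card(1) fin(2) card(2) y(2) k(1)] .
    then have yk: "y k > 0" using y(1)[OF k(1)] by simp
    have le: "price \<psi> J c (\<psi> i) \<le> c i" if "i \<in> L" for i
      using that J(3) L(2) price_basis[OF bJ] by (cases "i \<in> J") (auto intro: less_imp_le)
    have "price \<psi> J c a = (\<Sum>i\<in>L. y i * price \<psi> J c (\<psi> i))"
      unfolding y(2) by (rule price_sum[OF bJ])
    also have "\<dots> < (\<Sum>i\<in>L. y i * c i)"
      using fin(2) y(1) le k J(3) L(2) yk by (intro sum_strict_mono_ex1) (auto intro!: mult_left_mono bexI[of _ k])
    also have "\<dots> = price \<psi> L c a" unfolding y(2) price_sum_basis[OF bL] ..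
    finally show ?thesis .
  qed
  show "J = L"
  proof (rule ccontr)
    assume "J \<noteq> L"
    then have "price \<psi> J c a < price \<psi> L c a" "price \<psi> L c a < price \<psi> J c a"
      using less[of J L] less[of L J] J L by blast+
    then show False by simp
  qed
qed

text \<open>
  Group the faces according to their optimal vertex.  The faces belonging to \<open>J\<close> form the
  interval from \<open>J\<close> to \<open>J \<union> W J\<close>, and the alternating sum of those that contain \<open>B\<close> is zero
  unless this leaves exactly one of them.
\<close>

lemma signed_count_vertex_bases:
  fixes \<psi> :: "nat \<Rightarrow> 'a::euclidean_space"
  assumes S: "finite S" "\<psi> ` S \<subseteq> F" and gp: "general_position F \<psi> S a"
    and pos: "positively_independent \<psi> S"
    and gen: "\<And>J j. \<lbrakk>J \<in> vertex_bases F \<psi> S a; j \<in> S - J\<rbrakk> \<Longrightarrow> price \<psi> J c (\<psi> j) \<noteq> c j"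
    and B: "B \<subseteq> S"
  defines "W \<equiv> \<lambda>J. {j \<in> S - J. price \<psi> J c (\<psi> j) < c j}"
  shows "signed_count S (\<lambda>I. a \<in> gen_cone \<psi> I) B
    = (\<Sum>J\<in>vertex_bases F \<psi> S a. of_bool (B - J = W J) * (- 1) ^ card (J \<union> W J))"
proof -
  let ?V = "vertex_bases F \<psi> S a"
  have V: "finite ?V" "\<And>J. J \<in> ?V \<Longrightarrow> J \<subseteq> S"
    using finite_vertex_bases[OF S(1)] by (auto simp: vertex_bases_def)
  have split: "of_bool (a \<in> gen_cone \<psi> I) = (\<Sum>J\<in>?V. of_bool (J \<subseteq> I \<and> I \<subseteq> J \<union> W J) :: int)"
    if I: "I \<subseteq> S" for I
  proof (cases "a \<in> gen_cone \<psi> I")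
    case True
    have "\<exists>!J. J \<in> ?V \<and> J \<subseteq> I \<and> I \<subseteq> J \<union> W J"
    proof -
      have "(\<forall>j\<in>I - J. price \<psi> J c (\<psi> j) < c j) \<longleftrightarrow> I \<subseteq> J \<union> W J" for J
        using I by (auto simp: W_def)
      then show ?thesis using ex1_optimal_vertex_basis[OF S gp pos gen I True] by (simp only:)
    qed
    then obtain J where J: "J \<in> ?V \<and> J \<subseteq> I \<and> I \<subseteq> J \<union> W J"
      and uniq: "\<forall>L. L \<in> ?V \<and> L \<subseteq> I \<and> I \<subseteq> L \<union> W L \<longrightarrow> L = J" by (elim ex1E)
    have "L \<subseteq> I \<and> I \<subseteq> L \<union> W L \<longleftrightarrow> L = J" if "L \<in> ?V" for L using that J uniq by metis
    then have "(\<Sum>L\<in>?V. of_bool (L \<subseteq> I \<and> I \<subseteq> L \<union> W L) :: int) = (\<Sum>L\<in>?V. of_bool (L = J))"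
      by (intro sum.cong) (simp_all only: refl)
    also have "\<dots> = 1" using V(1) J by (simp add: of_bool_def)
    finally show ?thesis using True by simp
  next
    case False
    have "\<not> J \<subseteq> I" if "J \<in> ?V" for J
      using False that gen_cone_mono[of J I \<psi>] finite_subset[OF I S(1)] by (auto simp: vertex_bases_def)
    then show ?thesis using False by auto
  qed
  have inner: "(\<Sum>I\<in>Pow S. of_bool (B \<subseteq> I \<and> J \<subseteq> I \<and> I \<subseteq> J \<union> W J) * (- 1) ^ card I)
      = (of_bool (B - J = W J) * (- 1) ^ card (J \<union> W J) :: int)" if J: "J \<in> ?V" for J
  proof -
    have W: "W J \<subseteq> S" "W J \<inter> J = {}" by (auto simp: W_def)
    consider (toggle) k where "k \<in> W J" "k \<notin> B" | (empty) "W J \<subseteq> B" "\<not> B \<subseteq> J \<union> W J"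
      | (one) "B - J = W J" using W by blast
    then show ?thesis
    proof cases
      case toggle
      have "(\<Sum>I\<in>Pow S. of_bool (B \<subseteq> I \<and> J \<subseteq> I \<and> I \<subseteq> J \<union> W J) * (- 1) ^ card I) = (0::int)"
        using toggle W S(1) by (intro alternating_sum_toggle[of _ k] arg_cong[of _ _ of_bool]) auto
      then show ?thesis using toggle W by auto
    next
      case empty
      then have "(\<Sum>I\<in>Pow S. of_bool (B \<subseteq> I \<and> J \<subseteq> I \<and> I \<subseteq> J \<union> W J) * (- 1) ^ card I) = (0::int)"
        by (intro sum.neutral) auto
      then show ?thesis using empty by auto
    next
      case one
      have "(\<Sum>I\<in>Pow S. of_bool (B \<subseteq> I \<and> J \<subseteq> I \<and> I \<subseteq> J \<union> W J) * (- 1) ^ card I)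
          = (\<Sum>I\<in>Pow S. if I = J \<union> W J then (- 1) ^ card I else (0::int))"
        using one by (intro sum.cong) auto
      also have "\<dots> = (- 1) ^ card (J \<union> W J)" using S(1) W V(2)[OF J] by simp
      finally show ?thesis using one by simp
    qed
  qed
  have "signed_count S (\<lambda>I. a \<in> gen_cone \<psi> I) B
      = (\<Sum>I\<in>Pow S. \<Sum>J\<in>?V. of_bool (B \<subseteq> I \<and> J \<subseteq> I \<and> I \<subseteq> J \<union> W J) * (- 1) ^ card I)"
    unfolding signed_count_def
  proof (rule sum.cong[OF refl])
    fix I assume "I \<in> Pow S"
    then have I: "I \<subseteq> S" by simp
    have "of_bool (B \<subseteq> I \<and> a \<in> gen_cone \<psi> I) * (- 1) ^ card I
      = of_bool (B \<subseteq> I) * (\<Sum>J\<in>?V. of_bool (J \<subseteq> I \<and> I \<subseteq> J \<union> W J)) * (- 1 :: int) ^ card I"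
      by (subst of_bool_conj, subst split[OF I]) (rule refl)
    then show "of_bool (B \<subseteq> I \<and> a \<in> gen_cone \<psi> I) * (- 1) ^ card I
      = (\<Sum>J\<in>?V. of_bool (B \<subseteq> I \<and> J \<subseteq> I \<and> I \<subseteq> J \<union> W J) * (- 1) ^ card I :: int)"
      by (simp only: of_bool_conj sum_distrib_left sum_distrib_right mult.assoc)
  qed
  also have "\<dots> = (\<Sum>J\<in>?V. of_bool (B - J = W J) * (- 1) ^ card (J \<union> W J))"
    using inner by (subst sum.swap) (rule sum.cong[OF refl])
  finally show ?thesis .
qed

text \<open>
  The reduced cost of \<open>j\<close> at the basis \<open>J\<close> is a linear function of \<open>c\<close>; it is not the zero
  function because the coefficient of \<open>c j\<close> is \<open>1\<close>.
\<close>

lemma generic_prices: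
  fixes \<psi> :: "nat \<Rightarrow> 'a::euclidean_space"
  assumes S: "finite S" "\<psi> ` S \<subseteq> F" and gp: "general_position F \<psi> S a"
    and E: "finite E" "\<And>\<beta>. \<beta> \<in> E \<Longrightarrow> (\<Sum>i\<in>S. \<beta> i * w i) > 0"
  shows "\<exists>c. (\<forall>\<beta>\<in>E. (\<Sum>i\<in>S. \<beta> i * c i) > 0)
    \<and> (\<forall>J\<in>vertex_bases F \<psi> S a. \<forall>j\<in>S - J. price \<psi> J c (\<psi> j) \<noteq> c j)"
proof -
  let ?V = "vertex_bases F \<psi> S a"
  have bas: "basis_indices F \<psi> J" if "J \<in> ?V" for J
    using vertex_bases_basis_indices[OF S(1) gp that] .
  have JS: "J \<subseteq> S" if "J \<in> ?V" for J using that by (auto simp: vertex_bases_def)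
  have "\<exists>u. \<psi> j = (\<Sum>i\<in>J. u i *\<^sub>R \<psi> i)" if "J \<in> ?V" "j \<in> S" for J j
  proof -
    have "finite J" "\<psi> j \<in> span (\<psi> ` J)" using bas[OF that(1)] that(2) S(2) by (auto simp: basis_indices_def)
    then show ?thesis using span_image_sum by blast
  qed
  then obtain u where u: "\<And>J j. \<lbrakk>J \<in> ?V; j \<in> S\<rbrakk> \<Longrightarrow> \<psi> j = (\<Sum>i\<in>J. u J j i *\<^sub>R \<psi> i)" by metis
  define \<gamma> where "\<gamma> J j i = of_bool (i = j) - (if i \<in> J then u J j i else 0)" for J j i
  define D where "D = (\<lambda>(J, j). \<gamma> J j) ` (SIGMA J:?V. S - J)"
  have D: "finite D" unfolding D_def using S(1) finite_vertex_bases[OF S(1)]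
    by (intro finite_imageI finite_SigmaI) auto
  have nz: "\<exists>i\<in>S. \<delta> i \<noteq> 0" if "\<delta> \<in> D" for \<delta>
  proof -
    obtain J j where "J \<in> ?V" "j \<in> S - J" "\<delta> = \<gamma> J j" using \<open>\<delta> \<in> D\<close> by (auto simp: D_def)
    then show ?thesis by (intro bexI[of _ j]) (auto simp: \<gamma>_def)
  qed
  obtain c where c: "\<And>\<beta>. \<beta> \<in> E \<Longrightarrow> (\<Sum>i\<in>S. \<beta> i * c i) > 0" "\<And>\<delta>. \<delta> \<in> D \<Longrightarrow> (\<Sum>i\<in>S. \<delta> i * c i) \<noteq> 0"
    using generic_perturbation[of S E D w, OF S(1) E(1) D E(2) nz] by metis
  have "price \<psi> J c (\<psi> j) \<noteq> c j" if J: "J \<in> ?V" and j: "j \<in> S - J" for J j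
  proof -
    have "\<gamma> J j \<in> D" using J j by (force simp: D_def)
    then have ne: "(\<Sum>i\<in>S. \<gamma> J j i * c i) \<noteq> 0" by (rule c(2))
    have "(\<Sum>i\<in>S. \<gamma> J j i * c i) = (\<Sum>i\<in>S. of_bool (i = j) * c i) - (\<Sum>i\<in>S. (if i \<in> J then u J j i * c i else 0))"
      unfolding sum_subtractf[symmetric] by (rule sum.cong) (auto simp: \<gamma>_def algebra_simps)
    also have "(\<Sum>i\<in>S. (if i \<in> J then u J j i * c i else 0)) = (\<Sum>i\<in>J. u J j i * c i)"
      using S(1) JS[OF J] by (simp add: sum.inter_restrict[symmetric] Int_absorb1)
    also have "\<dots> = price \<psi> J c (\<psi> j)"
      using price_sum_basis[OF bas[OF J], of c "u J j"] u[OF J, of j] j by simp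
    also have "(\<Sum>i\<in>S. of_bool (i = j) * c i) = c j"
      using S(1) j by (simp add: of_bool_def if_distrib[of "\<lambda>t. t * _"] cong: if_cong)
    finally show ?thesis using ne by simp
  qed
  then show ?thesis using c(1) by blast
qed

text \<open>
  If a vertex \<open>J\<close> survives in \<open>signed_count_vertex_bases\<close>, then the reduced costs are positive on
  \<open>B - J\<close>, zero on \<open>J\<close> and negative elsewhere.  Pairing them with \<open>x\<close> gives
  \<open>(\<Sum>i. x i * c i) \<le> s * (cost of J)\<close>.  So there is no surviving vertex if the cost \<open>w\<close>, and hence
  also a generic cost near \<open>w\<close>, violates this inequality at all vertices.
\<close>

lemma signed_count_eq_0:
  fixes \<psi> :: "nat \<Rightarrow> 'a::euclidean_space" and s :: real
  assumes S: "finite S" "\<psi> ` S \<subseteq> F" and gp: "general_position F \<psi> S a"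
    and pos: "positively_independent \<psi> S" and B: "B \<subseteq> S"
    and x: "\<And>i. i \<in> B \<Longrightarrow> x i \<le> 0" "\<And>i. i \<in> S - B \<Longrightarrow> x i \<ge> 0"
    and xa: "(\<Sum>i\<in>S. x i *\<^sub>R \<psi> i) = s *\<^sub>R a"
    and less: "\<And>J y. \<lbrakk>J \<subseteq> S; \<And>i. i \<in> J \<Longrightarrow> y i \<ge> 0; a = (\<Sum>i\<in>J. y i *\<^sub>R \<psi> i)\<rbrakk>
      \<Longrightarrow> s * (\<Sum>i\<in>J. y i * w i) < (\<Sum>i\<in>S. x i * w i)"
  shows "signed_count S (\<lambda>I. a \<in> gen_cone \<psi> I) B = 0"
proof -
  let ?V = "vertex_bases F \<psi> S a"
  have bas: "basis_indices F \<psi> J" if "J \<in> ?V" for J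
    using vertex_bases_basis_indices[OF S(1) gp that] .
  have JS: "J \<subseteq> S" if "J \<in> ?V" for J using that by (auto simp: vertex_bases_def)
  have "\<exists>y. (\<forall>i\<in>J. y i \<ge> 0) \<and> a = (\<Sum>i\<in>J. y i *\<^sub>R \<psi> i)" if "J \<in> ?V" for J
    using that unfolding vertex_bases_def gen_cone_def by blast
  then obtain y where y: "\<And>J i. \<lbrakk>J \<in> ?V; i \<in> J\<rbrakk> \<Longrightarrow> y J i \<ge> 0"
      "\<And>J. J \<in> ?V \<Longrightarrow> a = (\<Sum>i\<in>J. y J i *\<^sub>R \<psi> i)" by metis
  \<comment> \<open>\<open>\<beta> J\<close> collects the coefficients of the linear inequality that \<open>w\<close> satisfies at the vertex \<open>J\<close>\<close>
  define \<beta> where "\<beta> J i = x i - s * (if i \<in> J then y J i else 0)" for J i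
  have \<beta>: "(\<Sum>i\<in>S. \<beta> J i * c i) = (\<Sum>i\<in>S. x i * c i) - s * (\<Sum>i\<in>J. y J i * c i)"
    if "J \<in> ?V" for J and c
  proof -
    have "(\<Sum>i\<in>S. \<beta> J i * c i) = (\<Sum>i\<in>S. x i * c i) - s * (\<Sum>i\<in>S. (if i \<in> J then y J i * c i else 0))"
      unfolding sum_subtractf[symmetric] sum_distrib_left by (rule sum.cong) (auto simp: \<beta>_def algebra_simps)
    also have "(\<Sum>i\<in>S. (if i \<in> J then y J i * c i else 0)) = (\<Sum>i\<in>J. y J i * c i)"
      using S(1) JS[OF that] by (simp add: sum.inter_restrict[symmetric] Int_absorb1)
    finally show ?thesis .
  qed
  have E: "finite (\<beta> ` ?V)" using finite_vertex_bases[OF S(1)] by (rule finite_imageI)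
  have Ew: "(\<Sum>i\<in>S. b i * w i) > 0" if b: "b \<in> \<beta> ` ?V" for b
  proof -
    obtain J where J: "J \<in> ?V" "b = \<beta> J" using b by blast
    then show ?thesis using \<beta>[OF J(1), of w] less[OF JS[OF J(1)] y(1)[OF J(1)] y(2)[OF J(1)]] by simp
  qed
  obtain c where c: "\<forall>b\<in>\<beta> ` ?V. (\<Sum>i\<in>S. b i * c i) > 0"
    and c': "\<forall>J\<in>?V. \<forall>j\<in>S - J. price \<psi> J c (\<psi> j) \<noteq> c j"
    using generic_prices[OF S gp E Ew] by blast
  have gen: "price \<psi> J c (\<psi> j) \<noteq> c j" if "J \<in> ?V" "j \<in> S - J" for J j
    using c' that by blast
  have "B - J \<noteq> {j \<in> S - J. price \<psi> J c (\<psi> j) < c j}" if J: "J \<in> ?V" for J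
  proof
    assume eq: "B - J = {j \<in> S - J. price \<psi> J c (\<psi> j) < c j}"
    have "(\<Sum>i\<in>S. x i * price \<psi> J c (\<psi> i)) = price \<psi> J c (s *\<^sub>R a)"
      unfolding xa[symmetric] price_sum[OF bas[OF J]] ..
    also have "\<dots> = s * (\<Sum>i\<in>J. y J i * c i)"
      using price_sum_basis[OF bas[OF J], of c "y J"] y(2)[OF J] linear_price[OF bas[OF J]]
      by (simp add: linear_scale)
    finally have "(\<Sum>i\<in>S. \<beta> J i * c i) = (\<Sum>i\<in>S. x i * (c i - price \<psi> J c (\<psi> i)))"
      by (simp add: \<beta>[OF J] right_diff_distrib sum_subtractf)
    also have "\<dots> \<le> 0"
    proof (rule sum_nonpos)
      fix i assume i: "i \<in> S"
      consider "i \<in> J" | "i \<in> B - J" | "i \<in> S - B" "i \<notin> J" using i by blast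
      then show "x i * (c i - price \<psi> J c (\<psi> i)) \<le> 0"
      proof cases
        case 1
        then show ?thesis using price_basis[OF bas[OF J]] by simp
      next
        case 2
        then have "price \<psi> J c (\<psi> i) < c i" "x i \<le> 0" using eq x(1) by auto
        then show ?thesis by (intro mult_nonpos_nonneg) auto
      next
        case 3
        then have "\<not> price \<psi> J c (\<psi> i) < c i" "x i \<ge> 0" using eq x(2) by auto
        then show ?thesis by (intro mult_nonneg_nonpos) auto
      qed
    qed
    finally show False using c J by force
  qed
  then show ?thesis
    by (subst signed_count_vertex_bases[OF S gp pos gen B]) auto
qed

text \<open>
  For \<open>B = {}\<close> a vertex survives in \<open>signed_count_vertex_bases\<close> if no edge direction increases the
  cost.  This is the unique optimal vertex of the whole polytope for the cost \<open>- c\<close>.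
\<close>

lemma signed_count_empty:
  fixes \<psi> :: "nat \<Rightarrow> 'a::euclidean_space"
  assumes S: "finite S" "\<psi> ` S \<subseteq> F" and gp: "general_position F \<psi> S a"
    and pos: "positively_independent \<psi> S" and a: "a \<in> gen_cone \<psi> S"
  shows "signed_count S (\<lambda>I. a \<in> gen_cone \<psi> I) {} = (- 1) ^ dim F"
proof -
  let ?V = "vertex_bases F \<psi> S a"
  obtain c where c: "\<forall>J\<in>?V. \<forall>j\<in>S - J. price \<psi> J c (\<psi> j) \<noteq> c j"
    using generic_prices[OF S gp, of "{}" "\<lambda>_. 0"] by auto
  have gen: "price \<psi> J c (\<psi> j) \<noteq> c j" if "J \<in> ?V" "j \<in> S - J" for J j
    using c that by blast
  have neg: "price \<psi> J (\<lambda>i. - c i) (\<psi> j) = - price \<psi> J c (\<psi> j)" if "J \<in> ?V" "j \<in> S" for J j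
  proof -
    have bas: "basis_indices F \<psi> J" using vertex_bases_basis_indices[OF S(1) gp that(1)] .
    then have "finite J" "\<psi> j \<in> span (\<psi> ` J)" using that S(2) by (auto simp: basis_indices_def)
    then obtain u where u: "\<psi> j = (\<Sum>i\<in>J. u i *\<^sub>R \<psi> i)" using span_image_sum by blast
    show ?thesis unfolding u price_sum_basis[OF bas] by (simp add: sum_negf)
  qed
  have "\<exists>!J. J \<in> ?V \<and> J \<subseteq> S \<and> (\<forall>j\<in>S - J. price \<psi> J (\<lambda>i. - c i) (\<psi> j) < - c j)"
    using gen neg by (intro ex1_optimal_vertex_basis[OF S gp pos _ _ a]) auto
  then obtain J where J: "J \<in> ?V \<and> J \<subseteq> S \<and> (\<forall>j\<in>S - J. price \<psi> J (\<lambda>i. - c i) (\<psi> j) < - c j)"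
    and uniq: "\<forall>L. L \<in> ?V \<and> L \<subseteq> S \<and> (\<forall>j\<in>S - L. price \<psi> L (\<lambda>i. - c i) (\<psi> j) < - c j) \<longrightarrow> L = J"
    by (elim ex1E)
  have iff: "{} - L = {j \<in> S - L. price \<psi> L c (\<psi> j) < c j} \<longleftrightarrow> L = J" if L: "L \<in> ?V" for L
  proof
    assume "{} - L = {j \<in> S - L. price \<psi> L c (\<psi> j) < c j}"
    then have "price \<psi> L c (\<psi> j) > c j" if "j \<in> S - L" for j
      using that gen[OF L that] by (auto simp: not_less)
    then have "\<forall>j\<in>S - L. price \<psi> L (\<lambda>i. - c i) (\<psi> j) < - c j" using neg[OF L] by auto
    moreover have "L \<subseteq> S" using L by (auto simp: vertex_bases_def)
    ultimately show "L = J" using uniq L by blast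
  next
    assume "L = J"
    then show "{} - L = {j \<in> S - L. price \<psi> L c (\<psi> j) < c j}" using J neg[of J] by force
  qed
  have "signed_count S (\<lambda>I. a \<in> gen_cone \<psi> I) {} = (\<Sum>L\<in>?V. if L = J then (- 1) ^ card L else 0)"
  proof (subst signed_count_vertex_bases[OF S gp pos gen empty_subsetI], assumption, assumption, rule sum.cong[OF refl])
    fix L assume L: "L \<in> ?V"
    show "of_bool ({} - L = {j \<in> S - L. price \<psi> L c (\<psi> j) < c j})
        * (- 1) ^ card (L \<union> {j \<in> S - L. price \<psi> L c (\<psi> j) < c j})
      = (if L = J then (- 1) ^ card L else (0 :: int))"
    proof (cases "L = J")
      case True
      then have "{j \<in> S - L. price \<psi> L c (\<psi> j) < c j} = {}" using iff[OF L] by blast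
      then show ?thesis using True by (simp only: Un_empty_right) simp
    next
      case False
      then show ?thesis using iff[OF L] by (simp only: of_bool_eq) simp
    qed
  qed
  also have "\<dots> = (- 1) ^ card J" using J finite_vertex_bases[OF S(1), of F \<psi> a] by simp
  also have "card J = dim F" using J by (auto simp: vertex_bases_def)
  finally show ?thesis .
qed

text \<open>
  If \<open>x k < 0\<close> for some \<open>k \<in> B\<close>, then the cost \<open>y \<mapsto> - y k\<close> is positive at \<open>x\<close> and \<open>\<le> 0\<close> on the
  polytope.  If \<open>x\<close> vanishes on \<open>B\<close>, the support of \<open>x\<close> still spans \<open>F\<close> by general position, so
  \<open>x\<close> can be changed slightly along a relation between \<open>\<psi> k\<close> and the support to make \<open>x k\<close> negative.
\<close>

lemma signed_count_orthant:
  fixes \<psi> :: "nat \<Rightarrow> 'a::euclidean_space"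
  assumes S: "finite S" "\<psi> ` S \<subseteq> F" and gp: "general_position F \<psi> S a"
    and pos: "positively_independent \<psi> S" and B: "B \<subseteq> S" "B \<noteq> {}"
    and x: "\<And>i. i \<in> B \<Longrightarrow> x i \<le> 0" "\<And>i. i \<in> S - B \<Longrightarrow> x i \<ge> 0"
    and xa: "a = (\<Sum>i\<in>S. x i *\<^sub>R \<psi> i)"
  shows "signed_count S (\<lambda>I. a \<in> gen_cone \<psi> I) B = 0"
proof -
  have strict: ?thesis
    if k: "k \<in> B" "x k < 0" and x: "\<And>i. i \<in> B \<Longrightarrow> x i \<le> 0" "\<And>i. i \<in> S - B \<Longrightarrow> x i \<ge> 0"
      and xa: "a = (\<Sum>i\<in>S. x i *\<^sub>R \<psi> i)" for k and x :: "nat \<Rightarrow> real"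
  proof (rule signed_count_eq_0[OF S gp pos B(1) x, where s = 1 and w = "\<lambda>i. - of_bool (i = k)"])
    fix J and y :: "nat \<Rightarrow> real"
    assume J: "J \<subseteq> S" and y: "\<And>i. i \<in> J \<Longrightarrow> y i \<ge> 0"
    have "(\<Sum>i\<in>J. y i * - of_bool (i = k)) \<le> 0"
      using y by (intro sum_nonpos) auto
    also have "0 < - x k" using k by simp
    also have "- x k = (\<Sum>i\<in>S. x i * - of_bool (i = k))"
      using S(1) k(1) B(1) by (auto simp: sum.remove[of S k])
    finally show "1 * (\<Sum>i\<in>J. y i * - of_bool (i = k)) < (\<Sum>i\<in>S. x i * - of_bool (i = k))" by simp
  qed (use xa in simp_all)
  show ?thesis
  proof (cases "\<exists>k\<in>B. x k < 0")
    case True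
    then show ?thesis using strict[OF _ _ x xa] by blast
  next
    case False
    then have xB: "x i = 0" if "i \<in> B" for i using x(1)[OF that] that by force
    obtain k where k: "k \<in> B" using B(2) by blast
    define K where "K = {i \<in> S. x i \<noteq> 0}"
    have K: "finite K" "K \<subseteq> S" "K \<inter> B = {}" using S(1) xB by (auto simp: K_def)
    have xK: "a = (\<Sum>i\<in>K. x i *\<^sub>R \<psi> i)"
      unfolding xa using S(1) by (intro sum.mono_neutral_right) (auto simp: K_def)
    then have "a \<in> span (\<psi> ` K)" by (auto intro!: span_sum span_scale intro: span_base)
    then have "\<psi> k \<in> span (\<psi> ` K)" using general_position_span[OF gp K(2)] S(2) B(1) k by blast
    then obtain u where u: "\<psi> k = (\<Sum>i\<in>K. u i *\<^sub>R \<psi> i)" using span_image_sum K(1) by blast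
    have "eventually (\<lambda>e. \<forall>i\<in>K. x i + e * u i > 0) (at_right 0)"
    proof (intro eventually_ball_finite ballI)
      fix i assume "i \<in> K"
      then have "x i > 0" using x(2)[of i] K by (force simp: K_def)
      moreover have "((\<lambda>e. x i + e * u i) \<longlongrightarrow> x i) (at_right 0)" by (auto intro!: tendsto_eq_intros)
      ultimately show "eventually (\<lambda>e. x i + e * u i > 0) (at_right 0)" by (rule order_tendstoD(1)[rotated])
    qed (rule K(1))
    then have "eventually (\<lambda>e. (\<forall>i\<in>K. x i + e * u i > 0) \<and> e > 0) (at_right 0)"
      using eventually_at_right_less by (rule eventually_conj)
    then obtain e where e: "\<And>i. i \<in> K \<Longrightarrow> x i + e * u i > 0" "e > (0::real)"
      using eventually_happens trivial_limit_at_right_real by blast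
    \<comment> \<open>add \<open>e\<close> times the relation \<open>\<psi> k = (\<Sum>i\<in>K. u i *\<^sub>R \<psi> i)\<close> to the coefficients \<open>x\<close>\<close>
    define x' where "x' i = (if i = k then - e else if i \<in> K then x i + e * u i else 0)" for i
    have "k \<notin> K" using k K by blast
    have "(\<Sum>i\<in>S. x' i *\<^sub>R \<psi> i) = (\<Sum>i\<in>insert k K. x' i *\<^sub>R \<psi> i)"
      using S(1) K k B(1) by (intro sum.mono_neutral_right) (auto simp: x'_def)
    also have "\<dots> = - e *\<^sub>R \<psi> k + (\<Sum>i\<in>K. (x i + e * u i) *\<^sub>R \<psi> i)"
      using \<open>k \<notin> K\<close> K(1) by (auto simp: x'_def intro!: sum.cong)
    also have "\<dots> = a"
      unfolding u xK by (simp add: scaleR_left_distrib sum.distrib scaleR_sum_right sum_negf)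
    finally have "a = (\<Sum>i\<in>S. x' i *\<^sub>R \<psi> i)" ..
    moreover have "x' i \<le> 0" if "i \<in> B" for i using that K e(2) by (auto simp: x'_def)
    moreover have "x' i \<ge> 0" if "i \<in> S - B" for i using that k e(1)[of i] by (auto simp: x'_def)
    moreover have "x' k < 0" using e(2) by (simp add: x'_def)
    ultimately show ?thesis using strict[OF k] by blast
  qed
qed

text \<open>
  The sum of squares \<open>(\<Sum>i. v i * v i) > 0\<close> shows that the cost \<open>v\<close> satisfies the hypothesis of
  \<open>signed_count_eq_0\<close> with \<open>s = 0\<close>.
\<close>

lemma signed_count_recession:
  fixes \<psi> :: "nat \<Rightarrow> 'a::euclidean_space"
  assumes S: "finite S" "\<psi> ` S \<subseteq> F" and gp: "general_position F \<psi> S a"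
    and pos: "positively_independent \<psi> S" and B: "B \<subseteq> S"
    and v: "\<And>i. i \<in> B \<Longrightarrow> v i \<le> 0" "\<And>i. i \<in> S - B \<Longrightarrow> v i \<ge> 0"
    and v0: "(\<Sum>i\<in>S. v i *\<^sub>R \<psi> i) = 0" and k: "k \<in> S" "v k \<noteq> 0"
  shows "signed_count S (\<lambda>I. a \<in> gen_cone \<psi> I) B = 0"
proof (rule signed_count_eq_0[OF S gp pos B v, where s = 0 and w = v])
  have "0 < v k * v k" using k(2) not_real_square_gt_zero by blast
  then have "0 < (\<Sum>i\<in>S. v i * v i)" using S(1) k by (intro sum_pos2[of _ k]) auto
  then show "0 * (\<Sum>i\<in>J. y i * v i) < (\<Sum>i\<in>S. v i * v i)" for J y by simp
qed (use v0 in simp_all)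

section \<open>Walls and topes\<close>

lemma span_flip: "span (flip A \<psi> ` K) = span (\<psi> ` K)"
proof -
  have sub: "span (flip A \<psi> ` K) \<subseteq> span (\<psi> ` K)" for \<psi> :: "nat \<Rightarrow> 'a"
  proof (rule span_minimal)
    show "flip A \<psi> ` K \<subseteq> span (\<psi> ` K)"
      by (auto simp: flip_def intro: span_base span_neg)
  qed simp
  have "flip A (flip A \<psi>) = \<psi>" by (auto simp: flip_def)
  then show ?thesis using sub[of \<psi>] sub[of "flip A \<psi>"] by auto
qed

text \<open>
  This description of the walls only involves spans of subfamilies, which do not change when
  some of the vectors are replaced by their negatives.
\<close>

lemma walls_eq:
  "walls F N \<psi> = {span (\<psi> ` K) | K. K \<subseteq> {1..N} \<and> dim (span (\<psi> ` K)) + 1 = dim F}"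
proof (intro set_eqI iffI)
  fix W assume "W \<in> walls F N \<psi>"
  then obtain S where S: "S \<subseteq> \<psi> ` {1..N}" "independent S" "card S + 1 = dim F" "W = span S"
    by (auto simp: walls_def)
  from S(1) obtain K where K: "K \<subseteq> {1..N}" "S = \<psi> ` K" by (auto simp: subset_image_iff)
  have "dim (span S) = card S" using S(2) by (simp add: dim_eq_card_independent)
  then show "W \<in> {span (\<psi> ` K) | K. K \<subseteq> {1..N} \<and> dim (span (\<psi> ` K)) + 1 = dim F}"
    using S K by auto
next
  fix W assume "W \<in> {span (\<psi> ` K) | K. K \<subseteq> {1..N} \<and> dim (span (\<psi> ` K)) + 1 = dim F}"
  then obtain K where K: "W = span (\<psi> ` K)" "K \<subseteq> {1..N}" "dim (span (\<psi> ` K)) + 1 = dim F" by auto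
  obtain S where S: "S \<subseteq> \<psi> ` K" "independent S" "\<psi> ` K \<subseteq> span S" "card S = dim (\<psi> ` K)"
    using basis_exists[of "\<psi> ` K"] by blast
  have "span S = span (\<psi> ` K)"
    using S(1,3) by (intro subset_antisym span_mono span_minimal subspace_span)
  moreover have "S \<subseteq> \<psi> ` {1..N}" using S(1) K(2) by blast
  ultimately show "W \<in> walls F N \<psi>" unfolding walls_def using S K by (auto intro!: exI[of _ S])
qed

lemma walls_flip: "walls F N (flip A \<psi>) = walls F N \<psi>"
  by (simp add: walls_eq span_flip)

lemma regular_flip: "regular F N (flip A \<psi>) = regular F N \<psi>"
  by (simp add: regular_def walls_flip)

lemma topes_flip: "topes F N (flip A \<psi>) = topes F N \<psi>"
  by (simp add: topes_def regular_flip)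

lemma adjacent_flip: "adjacent F N (flip A \<psi>) = adjacent F N \<psi>"
  by (simp add: adjacent_def walls_flip fun_eq_iff)

lemma finite_walls: "finite (walls F N \<psi>)"
proof (rule finite_subset)
  show "walls F N \<psi> \<subseteq> (\<lambda>K. span (\<psi> ` K)) ` Pow {1..N}" by (auto simp: walls_eq)
qed simp

lemma wallsD:
  assumes "W \<in> walls F N \<psi>" "subspace F" "\<psi> ` {1..N} \<subseteq> F"
  shows "subspace W" "W \<subseteq> F" "dim W + 1 = dim F"
proof -
  obtain K where K: "W = span (\<psi> ` K)" "K \<subseteq> {1..N}" "dim (span (\<psi> ` K)) + 1 = dim F"
    using assms(1) by (auto simp: walls_eq)
  then show "subspace W" "dim W + 1 = dim F" by auto
  show "W \<subseteq> F" unfolding K(1) using assms(2,3) K(2) by (intro span_minimal) auto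
qed

text \<open>
  A hyperplane of \<open>F\<close> is the kernel of the inner product with a normal vector.
\<close>

lemma wall_functional:
  fixes \<psi> :: "nat \<Rightarrow> 'a::euclidean_space"
  assumes "W \<in> walls F N \<psi>" "subspace F" "\<psi> ` {1..N} \<subseteq> F"
  obtains f :: "'a \<Rightarrow> real" where "linear f" "W = {x \<in> F. f x = 0}"
proof -
  note W = wallsD[OF assms]
  have sp: "span W = W" "span F = F" using W(1) assms(2) by (simp_all only: span_eq_iff)
  have "W \<noteq> F" using W(3) by auto
  then have "span W \<subset> span F" using W(2) by (simp add: sp psubset_eq)
  then obtain n where n: "n \<noteq> 0" "n \<in> F" "\<And>y. y \<in> W \<Longrightarrow> n \<bullet> y = 0"
    using orthogonal_to_subspace_exists_gen[of W F] sp by (auto simp: orthogonal_def)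
  let ?H = "{x \<in> F. n \<bullet> x = 0}"
  have H: "subspace ?H" using assms(2) by (auto simp: subspace_def inner_right_distrib)
  have "n \<notin> ?H" using n(1) by simp
  then have "?H \<subset> F" using n(2) by blast
  then have "dim ?H < dim F"
    using H assms(2) by (intro dim_psubset) (auto simp: span_eq_iff[THEN iffD2])
  then have "W = ?H" using W H n(3) by (intro subspace_dim_equal) auto
  moreover have "linear (\<lambda>x. n \<bullet> x)" by (rule bounded_linear.linear[OF bounded_linear_inner_right])
  ultimately show ?thesis using that by blast
qed

text \<open>
  A proper subspace spanned by some of the vectors is contained in a wall: enlarge the set of
  indices to a maximal one whose vectors do not span \<open>F\<close>.
\<close>

lemma regular_general_position:
  fixes \<psi> :: "nat \<Rightarrow> 'a::euclidean_space"
  assumes F: "subspace F" "span (\<psi> ` {1..N}) = F" and a: "a \<in> regular F N \<psi>"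
  shows "general_position F \<psi> {1..N} a"
  unfolding general_position_def
proof (intro conjI allI impI)
  show "a \<in> F" using a by (simp add: regular_def)
  fix K assume K: "K \<subseteq> {1..N}" "a \<in> span (\<psi> ` K)"
  show "span (\<psi> ` K) = F"
  proof (rule ccontr)
    assume ne: "span (\<psi> ` K) \<noteq> F"
    define \<K> where "\<K> = {L. K \<subseteq> L \<and> L \<subseteq> {1..N} \<and> span (\<psi> ` L) \<noteq> F}"
    have "finite \<K>" "\<K> \<noteq> {}" using K(1) ne by (auto simp: \<K>_def)
    then obtain L where L: "L \<in> \<K>" and max: "\<forall>M\<in>\<K>. L \<subseteq> M \<longrightarrow> L = M"
      using finite_has_maximal[of \<K>] by blast
    have LN: "K \<subseteq> L" "L \<subseteq> {1..N}" "span (\<psi> ` L) \<noteq> F" using L by (auto simp: \<K>_def)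
    have "L \<noteq> {1..N}" using LN(3) F(2) by blast
    then obtain k where k: "k \<in> {1..N}" "k \<notin> L" using LN(2) by blast
    have "insert k L \<notin> \<K>" using max k(2) by blast
    then have "span (\<psi> ` insert k L) = F" using LN k by (auto simp: \<K>_def)
    then have "dim F = dim (insert (\<psi> k) (\<psi> ` L))" by (metis dim_span image_insert)
    then have le: "dim F \<le> dim (span (\<psi> ` L)) + 1" by (simp add: dim_insert)
    have "span (\<psi> ` L) \<subset> F"
      using LN span_mono[of "\<psi> ` L" "\<psi> ` {1..N}"] F(2) by blast
    then have "dim (span (\<psi> ` L)) < dim F"
      using F(1) by (intro dim_psubset) (simp add: span_eq_iff[THEN iffD2])
    then have "dim (span (\<psi> ` L)) + 1 = dim F" using le by simp
    then have "span (\<psi> ` L) \<in> walls F N \<psi>" using LN(2) by (auto simp: walls_eq)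
    moreover have "a \<in> span (\<psi> ` L)" using K(2) LN(1) span_mono[of "\<psi> ` K" "\<psi> ` L"] by blast
    ultimately show False using a by (auto simp: regular_def)
  qed
qed

lemma linear_zero_on_segment:
  fixes f :: "'a::real_vector \<Rightarrow> real"
  assumes f: "linear f" and "f a \<ge> 0" "f b < 0"
  shows "\<exists>c\<in>closed_segment a b. f c = 0"
proof -
  define t where "t = f a / (f a - f b)"
  have t: "0 \<le> t" "t \<le> 1" "(1 - t) * f a + t * f b = 0"
    using assms(2,3) by (auto simp: t_def divide_simps)
  have "(1 - t) *\<^sub>R a + t *\<^sub>R b \<in> closed_segment a b" using t by (auto simp: in_segment)
  moreover have "f ((1 - t) *\<^sub>R a + t *\<^sub>R b) = 0" using t(3) by (simp add: linear_add[OF f] linear_scale[OF f])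
  ultimately show ?thesis by blast
qed

lemma linear_pos_on_segment:
  fixes f :: "'a::real_vector \<Rightarrow> real"
  assumes f: "linear f" and "f a > 0" "f b > 0" "c \<in> closed_segment a b"
  shows "f c > 0"
proof -
  obtain t where t: "0 \<le> t" "t \<le> 1" "c = (1 - t) *\<^sub>R a + t *\<^sub>R b" using assms(4) by (auto simp: in_segment)
  have "f c = (1 - t) * f a + t * f b" by (simp add: t(3) linear_add[OF f] linear_scale[OF f])
  moreover have "(1 - t) * f a + t * f b > 0"
    using t(1,2) assms(2,3) by (cases "t = 0") (auto intro!: add_nonneg_pos)
  ultimately show ?thesis by simp
qed

lemma closed_segment_subset_subspace:
  assumes "subspace F" "a \<in> F" "b \<in> F" shows "closed_segment a b \<subseteq> F"
  using assms by (intro closed_segment_subset subspace_imp_convex)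

text \<open>
  Choose a basis \<open>J \<subseteq> I\<close> with \<open>a\<close> in its cone.  A coordinate that becomes negative along the
  segment vanishes somewhere on it, which general position forbids.
\<close>

lemma gen_cone_const_on_segment:
  fixes \<psi> :: "nat \<Rightarrow> 'a::euclidean_space"
  assumes S: "finite S" "\<psi> ` S \<subseteq> F" and gp: "\<And>c. c \<in> closed_segment a b \<Longrightarrow> general_position F \<psi> S c"
    and I: "I \<subseteq> S" "a \<in> gen_cone \<psi> I"
  shows "b \<in> gen_cone \<psi> I"
proof -
  have gpa: "general_position F \<psi> S a" and gpb: "general_position F \<psi> S b" by (simp_all add: gp)
  obtain J where J: "J \<subseteq> I" "card J = dim F" "a \<in> gen_cone \<psi> J"
    by (rule caratheodory_general_position[OF S gpa I])
  then have "J \<in> vertex_bases F \<psi> S a" using I(1) by (auto simp: vertex_bases_def)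
  then have bas: "basis_indices F \<psi> J" by (rule vertex_bases_basis_indices[OF S(1) gpa])
  then have finJ: "finite J" by (simp add: basis_indices_def)
  obtain f :: "nat \<Rightarrow> 'a \<Rightarrow> real" where f: "\<forall>i. linear (f i)"
    "\<forall>i. \<forall>j\<in>J. f i (\<psi> j) = of_bool (i = j)"
    "\<forall>x\<in>F. x = (\<Sum>j\<in>J. f j x *\<^sub>R \<psi> j)"
    using basis_indices_coordinates[OF bas] by blast
  note lin = f(1)[rule_format]
  obtain y where y: "\<forall>i\<in>J. y i \<ge> 0" "a = (\<Sum>i\<in>J. y i *\<^sub>R \<psi> i)"
    using J(3) unfolding gen_cone_def by blast
  have "f j b \<ge> 0" if j: "j \<in> J" for j
  proof (rule ccontr)
    assume "\<not> f j b \<ge> 0"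
    moreover have "f j a \<ge> 0"
      unfolding y(2) using f(2) y(1) by (auto simp: linear_sum[OF lin] linear_scale[OF lin] intro!: sum_nonneg)
    ultimately obtain c where c: "c \<in> closed_segment a b" "f j c = 0"
      using linear_zero_on_segment[OF lin[of j], of a b] by auto
    note gpc = gp[OF c(1)]
    then have "c = (\<Sum>i\<in>J. f i c *\<^sub>R \<psi> i)" using f(3) by (auto simp: general_position_def)
    then have "f j c \<noteq> 0"
      using general_position_nonzero[OF gpc _ finJ _ _ j, of "\<lambda>i. f i c"] J I(1) by auto
    then show False using c(2) by simp
  qed
  then have "b \<in> gen_cone \<psi> J"
    using bspec[OF f(3), of b] gpb by (intro gen_coneI[of J "\<lambda>j. f j b"]) (auto simp: general_position_def)
  then show ?thesis using gen_cone_mono[OF J(1)] finite_subset[OF I(1) S(1)] by blast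
qed

lemma tope_same_sign:
  fixes f :: "'a::euclidean_space \<Rightarrow> real"
  assumes "\<tau> \<in> topes F N \<psi>" "linear f" "{x \<in> F. f x = 0} \<in> walls F N \<psi>"
    and "a \<in> \<tau>" "b \<in> \<tau>" "f a > 0"
  shows "f b > 0"
proof (rule ccontr)
  assume "\<not> f b > 0"
  have "connected (f ` \<tau>)"
    using assms(1,2) by (intro connected_continuous_image linear_continuous_on linear_conv_bounded_linear[THEN iffD1])
      (auto simp: topes_def dest: in_components_connected)
  then obtain x where "x \<in> \<tau>" "f x = 0"
    using connectedD_interval[of "f ` \<tau>" "f b" "f a" 0] assms(4-6) \<open>\<not> f b > 0\<close> by force
  moreover have "\<tau> \<subseteq> regular F N \<psi>" using assms(1) by (auto simp: topes_def dest: in_components_subset)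
  ultimately have "x \<in> {x \<in> F. f x = 0}" "x \<notin> {x \<in> F. f x = 0}" using assms(3) by (auto simp only: regular_def)
  then show False by blast
qed

lemma tope_subset_regular: "\<tau> \<in> topes F N \<psi> \<Longrightarrow> \<tau> \<subseteq> regular F N \<psi>"
  by (auto simp: topes_def dest: in_components_subset)

lemma tope_segment_regular:
  fixes \<psi> :: "nat \<Rightarrow> 'a::euclidean_space"
  assumes F: "subspace F" "\<psi> ` {1..N} \<subseteq> F" and \<tau>: "\<tau> \<in> topes F N \<psi>" "a \<in> \<tau>" "b \<in> \<tau>"
  shows "closed_segment a b \<subseteq> regular F N \<psi>"
proof
  fix c assume c: "c \<in> closed_segment a b"
  have ab: "a \<in> regular F N \<psi>" "b \<in> regular F N \<psi>" using tope_subset_regular[OF \<tau>(1)] \<tau> by auto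
  then have "c \<in> F" using closed_segment_subset_subspace[OF F(1), of a b] c by (auto simp: regular_def)
  moreover have "c \<notin> W" if W: "W \<in> walls F N \<psi>" for W
  proof
    assume "c \<in> W"
    obtain f :: "'a \<Rightarrow> real" where f: "linear f" "W = {x \<in> F. f x = 0}"
      by (rule wall_functional[OF W F])
    have wall: "{x \<in> F. f x = 0} \<in> walls F N \<psi>" "{x \<in> F. - f x = 0} \<in> walls F N \<psi>" using f(2) W by simp_all
    have lin: "linear (\<lambda>x. - f x)" using f(1) by (rule linear_compose_neg)
    have "f a \<noteq> 0" using ab(1) W f(2) by (auto simp: regular_def)
    then consider "f a > 0" | "- f a > 0" by linarith
    then have "f c \<noteq> 0"
    proof cases
      case 1
      have "f b > 0" by (rule tope_same_sign[OF \<tau>(1) f(1) wall(1) \<tau>(2,3) 1])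
      then show ?thesis using linear_pos_on_segment[OF f(1) 1 _ c] by simp
    next
      case 2
      have "- f b > 0" by (rule tope_same_sign[OF \<tau>(1) lin wall(2) \<tau>(2,3) 2])
      then show ?thesis using linear_pos_on_segment[OF lin 2 _ c] by simp
    qed
    then show False using \<open>c \<in> W\<close> f(2) by simp
  qed
  ultimately show "c \<in> regular F N \<psi>" by (auto simp: regular_def)
qed

lemma topes_eq_if_segment_regular:
  assumes "\<tau>1 \<in> topes F N \<psi>" "\<tau>2 \<in> topes F N \<psi>" "a \<in> \<tau>1" "b \<in> \<tau>2"
    and "closed_segment a b \<subseteq> regular F N \<psi>"
  shows "\<tau>1 = \<tau>2"
proof -
  have comp: "\<tau>1 \<in> components (regular F N \<psi>)" "\<tau>2 \<in> components (regular F N \<psi>)"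
    using assms(1,2) by (simp_all add: topes_def)
  have "\<tau>1 \<inter> closed_segment a b \<noteq> {}" using assms(3) by auto
  then have "closed_segment a b \<subseteq> \<tau>1"
    by (rule components_maximal[OF comp(1) connected_segment(1) assms(5)])
  then have "\<tau>1 \<inter> \<tau>2 \<noteq> {}" using assms(4) by auto
  then show ?thesis using components_eq[OF comp] by simp
qed

section \<open>Crossing a wall\<close>

text \<open>
  The segment from \<open>a\<close> to \<open>b\<close> meets the wall of \<open>f\<close> in \<open>m\<close> and meets no other wall.  In particular
  \<open>m\<close> lies on no other wall.
\<close>

definition crosses_wall ::
    "'a::euclidean_space set \<Rightarrow> nat \<Rightarrow> (nat \<Rightarrow> 'a) \<Rightarrow> ('a \<Rightarrow> real) \<Rightarrow> 'a \<Rightarrow> 'a \<Rightarrow> 'a \<Rightarrow> bool" where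
  "crosses_wall F N \<psi> f a b m \<longleftrightarrow>
     linear f \<and> {x \<in> F. f x = 0} \<in> walls F N \<psi> \<and> a \<in> F \<and> b \<in> F \<and> f a > 0 \<and> f b < 0 \<and>
     m \<in> closed_segment a b \<and> f m = 0 \<and>
     (\<forall>W\<in>walls F N \<psi>. W \<noteq> {x \<in> F. f x = 0} \<longrightarrow> closed_segment a b \<inter> W = {})"

lemma crosses_wall_sym: "crosses_wall F N \<psi> f a b m \<Longrightarrow> crosses_wall F N \<psi> (\<lambda>x. - f x) b a m"
  unfolding crosses_wall_def using linear_compose_neg[of f] by (simp add: closed_segment_commute)

lemma crosses_wall_flip: "crosses_wall F N (flip A \<psi>) = crosses_wall F N \<psi>"
  by (simp add: crosses_wall_def walls_flip fun_eq_iff)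

text \<open>
  The point \<open>m\<close> lies on no other wall, so a small push from \<open>m\<close> towards the side of \<open>a\<close>
  ends at a point that is on the same side of every wall as \<open>a\<close>.
\<close>

lemma crosses_wall_push:
  fixes \<psi> :: "nat \<Rightarrow> 'a::euclidean_space"
  assumes F: "subspace F" "\<psi> ` {1..N} \<subseteq> F" and cr: "crosses_wall F N \<psi> f a b m"
    and j: "j \<in> {1..N}" "f (\<psi> j) > 0"
  shows "\<exists>e>0. closed_segment a (m + e *\<^sub>R \<psi> j) \<subseteq> regular F N \<psi>"
proof -
  have f: "linear f" and ab: "a \<in> F" "b \<in> F" "f a > 0" and m: "m \<in> closed_segment a b" "f m = 0"
    and other: "\<And>W. \<lbrakk>W \<in> walls F N \<psi>; W \<noteq> {x \<in> F. f x = 0}\<rbrakk> \<Longrightarrow> closed_segment a b \<inter> W = {}"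
    using cr unfolding crosses_wall_def by blast+
  have segF: "closed_segment a b \<subseteq> F" using F(1) ab(1,2) by (rule closed_segment_subset_subspace)
  have mF: "m \<in> F" using segF m(1) by blast
  have jF: "\<psi> j \<in> F" using F(2) j(1) by blast
  have side: "eventually (\<lambda>e. closed_segment a (m + e *\<^sub>R \<psi> j) \<inter> W = {}) (at_right 0)"
    if W: "W = {x \<in> F. g x = 0}" "closed_segment a b \<inter> W = {}" and g: "linear g" "g a > 0"
    for W and g :: "'a \<Rightarrow> real"
  proof -
    have am: "closed_segment a m \<subseteq> closed_segment a b" using m(1) by (simp add: subset_closed_segment)
    have nz: "g c \<noteq> 0" if "c \<in> closed_segment a b" for c using that W segF by blast
    have "\<not> g m < 0"
    proof
      assume "g m < 0"
      then obtain c where "c \<in> closed_segment a m" "g c = 0"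
        using linear_zero_on_segment[OF g(1), of a m] g(2) by auto
      then show False using nz am by blast
    qed
    then have "g m > 0" using nz[OF m(1)] by simp
    moreover have "((\<lambda>e. g m + e * g (\<psi> j)) \<longlongrightarrow> g m) (at_right 0)" by (auto intro!: tendsto_eq_intros)
    ultimately have "eventually (\<lambda>e. g m + e * g (\<psi> j) > 0) (at_right 0)"
      by (rule order_tendstoD(1)[rotated])
    then show ?thesis
    proof eventually_elim
      case (elim e)
      then have "g (m + e *\<^sub>R \<psi> j) > 0" by (simp add: linear_add[OF g(1)] linear_scale[OF g(1)])
      then have "g c > 0" if "c \<in> closed_segment a (m + e *\<^sub>R \<psi> j)" for c
        using linear_pos_on_segment[OF g _ that] by simp
      then show ?case using W(1) by fastforce
    qed
  qed
  have "eventually (\<lambda>e. closed_segment a (m + e *\<^sub>R \<psi> j) \<inter> W = {}) (at_right 0)"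
    if W: "W \<in> walls F N \<psi>" "W \<noteq> {x \<in> F. f x = 0}" for W
  proof -
    obtain g :: "'a \<Rightarrow> real" where g: "linear g" "W = {x \<in> F. g x = 0}"
      by (rule wall_functional[OF W(1) F])
    have "g a \<noteq> 0" using other[OF W] g(2) ab(1) by auto
    then consider "g a > 0" | "- g a > 0" by linarith
    then show ?thesis
    proof cases
      case 1
      show ?thesis by (rule side[OF g(2) other[OF W] g(1) 1])
    next
      case 2
      have "W = {x \<in> F. - g x = 0}" using g(2) by simp
      then show ?thesis by (rule side[OF _ other[OF W] linear_compose_neg[OF g(1)] 2])
    qed
  qed
  then have "eventually (\<lambda>e. \<forall>W\<in>walls F N \<psi> - {{x \<in> F. f x = 0}}. closed_segment a (m + e *\<^sub>R \<psi> j) \<inter> W = {})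
      (at_right 0)"
    using finite_walls by (intro eventually_ball_finite) auto
  then have "eventually (\<lambda>e. (\<forall>W\<in>walls F N \<psi> - {{x \<in> F. f x = 0}}.
      closed_segment a (m + e *\<^sub>R \<psi> j) \<inter> W = {}) \<and> e > 0) (at_right 0)"
    using eventually_at_right_less by (rule eventually_conj)
  then obtain e :: real where e: "\<forall>W\<in>walls F N \<psi> - {{x \<in> F. f x = 0}}. closed_segment a (m + e *\<^sub>R \<psi> j) \<inter> W = {}"
      "e > 0"
    using eventually_happens trivial_limit_at_right_real by blast
  have "f (m + e *\<^sub>R \<psi> j) > 0"
    using m(2) e(2) j(2) by (simp add: linear_add[OF f] linear_scale[OF f])
  then have pos: "f c > 0" if "c \<in> closed_segment a (m + e *\<^sub>R \<psi> j)" for c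
    using linear_pos_on_segment[OF f ab(3) _ that] by simp
  have "m + e *\<^sub>R \<psi> j \<in> F" using F(1) mF jF by (intro subspace_add subspace_scale)
  then have sub: "closed_segment a (m + e *\<^sub>R \<psi> j) \<subseteq> F" using F(1) ab(1) by (intro closed_segment_subset_subspace)
  have "closed_segment a (m + e *\<^sub>R \<psi> j) \<subseteq> regular F N \<psi>"
  proof
    fix c assume c: "c \<in> closed_segment a (m + e *\<^sub>R \<psi> j)"
    have "c \<notin> W" if "W \<in> walls F N \<psi>" for W
    proof (cases "W = {x \<in> F. f x = 0}")
      case True
      then show ?thesis using pos[OF c] by simp
    next
      case False
      then show ?thesis using e(1) that c by blast
    qed
    then show "c \<in> regular F N \<psi>" using c sub by (auto simp: regular_def)
  qed
  then show ?thesis using e(2) by blast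
qed

lemma gen_cone_crosses_wall:
  fixes \<psi> :: "nat \<Rightarrow> 'a::euclidean_space"
  assumes F: "subspace F" "\<psi> ` {1..N} \<subseteq> F" "span (\<psi> ` {1..N}) = F"
    and cr: "crosses_wall F N \<psi> f a b m" and I: "I \<subseteq> {1..N}"
    and mI: "m \<in> gen_cone \<psi> (I \<inter> {i. f (\<psi> i) = 0})" and j: "j \<in> I" "f (\<psi> j) > 0"
  shows "a \<in> gen_cone \<psi> I"
proof -
  let ?U = "I \<inter> {i. f (\<psi> i) = 0}"
  have fin: "finite I" using I finite_subset by blast
  obtain e where e: "e > 0" "closed_segment a (m + e *\<^sub>R \<psi> j) \<subseteq> regular F N \<psi>"
    using crosses_wall_push[OF F(1,2) cr, of j] I j by blast
  obtain t where t: "\<forall>i\<in>?U. t i \<ge> 0" "m = (\<Sum>i\<in>?U. t i *\<^sub>R \<psi> i)"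
    using mI unfolding gen_cone_def by blast
  have jU: "j \<notin> ?U" using j(2) by simp
  have "m + e *\<^sub>R \<psi> j = (\<Sum>i\<in>insert j ?U. (t(j := e)) i *\<^sub>R \<psi> i)"
    using fin jU t(2) by (auto intro!: sum.cong)
  then have "m + e *\<^sub>R \<psi> j \<in> gen_cone \<psi> (insert j ?U)"
    using t(1) e(1) by (intro gen_coneI[of _ "t(j := e)"]) auto
  moreover have "gen_cone \<psi> (insert j ?U) \<subseteq> gen_cone \<psi> I" using fin j(1) by (intro gen_cone_mono) auto
  ultimately have mem: "m + e *\<^sub>R \<psi> j \<in> gen_cone \<psi> I" by blast
  show ?thesis
  proof (rule gen_cone_const_on_segment[of "{1..N}" \<psi> F "m + e *\<^sub>R \<psi> j" a])
    fix c assume "c \<in> closed_segment (m + e *\<^sub>R \<psi> j) a"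
    then have "c \<in> regular F N \<psi>" using e(2) by (auto simp: closed_segment_commute)
    then show "general_position F \<psi> {1..N} c" by (rule regular_general_position[OF F(1,3)])
  qed (use F I mem in auto)
qed

text \<open>
  Only cones with a facet on the crossed wall can distinguish \<open>a\<close> from \<open>b\<close>.  For the forward
  direction, take a basis \<open>J \<subseteq> I\<close> whose cone contains \<open>a\<close>; some coordinate \<open>j\<close> becomes negative at \<open>b\<close>,
  so it vanishes on the segment, and the facet of \<open>J\<close> opposite to \<open>j\<close> must span the crossed wall and
  contain \<open>m\<close>.  A vector of \<open>I\<close> on the other side would put \<open>b\<close> into the cone as well.
\<close>

lemma gen_cone_crossing_iff:
  fixes \<psi> :: "nat \<Rightarrow> 'a::euclidean_space"
  assumes F: "subspace F" "\<psi> ` {1..N} \<subseteq> F" "span (\<psi> ` {1..N}) = F"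
    and cr: "crosses_wall F N \<psi> f a b m" and I: "I \<subseteq> {1..N}"
  shows "a \<in> gen_cone \<psi> I \<and> b \<notin> gen_cone \<psi> I \<longleftrightarrow>
    m \<in> gen_cone \<psi> (I \<inter> {i. f (\<psi> i) = 0}) \<and> I \<inter> {i. f (\<psi> i) > 0} \<noteq> {} \<and> I \<inter> {i. f (\<psi> i) < 0} = {}"
    (is "?L \<longleftrightarrow> ?R")
proof
  have f: "linear f" and ab: "a \<in> F" "b \<in> F" "f a > 0" "f b < 0"
    and m: "m \<in> closed_segment a b" "f m = 0" and wall: "{x \<in> F. f x = 0} \<in> walls F N \<psi>"
    and other: "\<And>W. \<lbrakk>W \<in> walls F N \<psi>; W \<noteq> {x \<in> F. f x = 0}\<rbrakk> \<Longrightarrow> closed_segment a b \<inter> W = {}"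
    using cr unfolding crosses_wall_def by blast+
  have fin: "finite I" using I finite_subset by blast
  {
    assume R: ?R
    then obtain j where j: "j \<in> I" "f (\<psi> j) > 0" by blast
    have "b \<notin> gen_cone \<psi> I"
    proof
      assume "b \<in> gen_cone \<psi> I"
      then obtain t where t: "\<forall>i\<in>I. t i \<ge> 0" "b = (\<Sum>i\<in>I. t i *\<^sub>R \<psi> i)" unfolding gen_cone_def by blast
      have "f b = (\<Sum>i\<in>I. t i * f (\<psi> i))" unfolding t(2) by (simp add: linear_sum[OF f] linear_scale[OF f])
      moreover have "f (\<psi> i) \<ge> 0" if "i \<in> I" for i using R that by force
      ultimately have "f b \<ge> 0" using t(1) by (simp add: sum_nonneg)
      then show False using ab(4) by simp
    qed
    moreover have "a \<in> gen_cone \<psi> I" using gen_cone_crosses_wall[OF F cr I _ j] R by blast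
    ultimately show ?L by blast
  }
  assume L: ?L
  have gpa: "general_position F \<psi> {1..N} a"
  proof (rule regular_general_position[OF F(1,3)])
    have "a \<notin> W" if "W \<in> walls F N \<psi>" for W
      using other[OF that] ab(3) by (cases "W = {x \<in> F. f x = 0}") auto
    then show "a \<in> regular F N \<psi>" using ab(1) by (auto simp: regular_def)
  qed
  obtain J where J: "J \<subseteq> I" "card J = dim F" "a \<in> gen_cone \<psi> J"
    by (rule caratheodory_general_position[OF finite_atLeastAtMost F(2) gpa I conjunct1[OF L]])
  then have "J \<in> vertex_bases F \<psi> {1..N} a" using I by (auto simp: vertex_bases_def)
  then have bas: "basis_indices F \<psi> J" by (rule vertex_bases_basis_indices[OF finite_atLeastAtMost gpa])
  then have basD: "finite J" "inj_on \<psi> J" "independent (\<psi> ` J)" "span (\<psi> ` J) = F"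
    by (simp_all add: basis_indices_def)
  obtain h :: "nat \<Rightarrow> 'a \<Rightarrow> real" where h: "\<forall>i. linear (h i)"
    "\<forall>i. \<forall>j\<in>J. h i (\<psi> j) = of_bool (i = j)"
    "\<forall>x\<in>F. x = (\<Sum>j\<in>J. h j x *\<^sub>R \<psi> j)"
    using basis_indices_coordinates[OF bas] by blast
  note lin = h(1)[rule_format]
  obtain y where y: "\<forall>i\<in>J. y i \<ge> 0" "a = (\<Sum>i\<in>J. y i *\<^sub>R \<psi> i)"
    using J(3) unfolding gen_cone_def by blast
  have ha: "h j a \<ge> 0" if "j \<in> J" for j
    unfolding y(2) using h(2) y(1) by (auto simp: linear_sum[OF lin] linear_scale[OF lin] intro!: sum_nonneg)
  have segF: "closed_segment a b \<subseteq> F" using F(1) ab(1,2) by (rule closed_segment_subset_subspace)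
  have facet: "span (\<psi> ` (J - {j})) = {x \<in> F. f x = 0}"
    if j: "j \<in> J" and c: "c \<in> closed_segment a b" "h j c = 0" for j c
  proof -
    have "c = (\<Sum>i\<in>J. h i c *\<^sub>R \<psi> i)" by (rule bspec[OF h(3) subsetD[OF segF c(1)]])
    also have "\<dots> = (\<Sum>i\<in>J - {j}. h i c *\<^sub>R \<psi> i)" using c(2) j basD(1) by (simp add: sum.remove[of J j])
    also have "\<dots> \<in> span (\<psi> ` (J - {j}))" by (auto intro!: span_sum span_scale intro: span_base)
    finally have mem: "c \<in> span (\<psi> ` (J - {j}))" .
    have "independent (\<psi> ` (J - {j}))" using basD(3) by (rule independent_mono) auto
    then have "dim (span (\<psi> ` (J - {j}))) = card (\<psi> ` (J - {j}))" by (simp add: dim_eq_card_independent)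
    also have "\<dots> = card (J - {j})" by (rule card_image[OF inj_on_subset[OF basD(2) Diff_subset]])
    also have "\<dots> + 1 = card J" using card_Suc_Diff1[OF basD(1) j] by (simp only: Suc_eq_plus1)
    finally have "dim (span (\<psi> ` (J - {j}))) + 1 = dim F" using J(2) by simp
    then have "span (\<psi> ` (J - {j})) \<in> walls F N \<psi>" using J(1) I by (auto simp: walls_eq)
    then have "closed_segment a b \<inter> span (\<psi> ` (J - {j})) = {}" if "span (\<psi> ` (J - {j})) \<noteq> {x \<in> F. f x = 0}"
      using that by (rule other)
    then show ?thesis using mem c(1) by blast
  qed
  have "\<exists>j\<in>J. h j b < 0"
  proof (rule ccontr)
    assume "\<not> (\<exists>j\<in>J. h j b < 0)"
    then have "b \<in> gen_cone \<psi> J"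
      using bspec[OF h(3) ab(2)] by (intro gen_coneI[of J "\<lambda>j. h j b"]) (auto simp: not_less)
    then show False using L gen_cone_mono[OF J(1) fin, of \<psi>] by blast
  qed
  then obtain j where j: "j \<in> J" "h j b < 0" by blast
  obtain c where "c \<in> closed_segment a b" "h j c = 0"
    using linear_zero_on_segment[OF lin[of j] ha[OF j(1)] j(2)] by blast
  note wall_j = facet[OF j(1) this]
  have zero: "f (\<psi> i) = 0" if "i \<in> J - {j}" for i
    using wall_j that span_base[of "\<psi> i" "\<psi> ` (J - {j})"] by blast
  have f_eq: "f x = h j x * f (\<psi> j)" if "x \<in> F" for x
  proof -
    have "f x = (\<Sum>i\<in>J. h i x * f (\<psi> i))"
      using arg_cong[OF bspec[OF h(3) that], of f] by (simp add: linear_sum[OF f] linear_scale[OF f])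
    also have "\<dots> = h j x * f (\<psi> j)" using j(1) basD(1) zero by (simp add: sum.remove[of J j])
    finally show ?thesis .
  qed
  have fj: "f (\<psi> j) > 0"
  proof (rule ccontr)
    assume "\<not> f (\<psi> j) > 0"
    then have "h j a * f (\<psi> j) \<le> 0" using ha[OF j(1)] by (intro mult_nonneg_nonpos) auto
    then show False using f_eq[OF ab(1)] ab(3) by simp
  qed
  have mF: "m \<in> F" using m(1) segF by blast
  have "h j m = 0" using f_eq[OF mF] m(2) fj by simp
  have hm: "h i m \<ge> 0" if i: "i \<in> J - {j}" for i
  proof (rule ccontr)
    assume "\<not> h i m \<ge> 0"
    then obtain c where c: "c \<in> closed_segment a m" "h i c = 0"
      using linear_zero_on_segment[OF lin[of i], of a m] ha[of i] i by auto
    moreover have "closed_segment a m \<subseteq> closed_segment a b" using m(1) by (simp add: subset_closed_segment)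
    ultimately have "span (\<psi> ` (J - {i})) = {x \<in> F. f x = 0}" using facet[of i c] i by blast
    moreover have "\<psi> j \<in> span (\<psi> ` (J - {i}))" using i j(1) by (intro span_base) auto
    ultimately show False using fj by simp
  qed
  have "m = (\<Sum>i\<in>J - {j}. h i m *\<^sub>R \<psi> i)"
    using bspec[OF h(3) mF] \<open>h j m = 0\<close> j(1) basD(1) by (simp add: sum.remove[of J j])
  then have "m \<in> gen_cone \<psi> (J - {j})" using hm by (intro gen_coneI[of _ "\<lambda>i. h i m"])
  moreover have "gen_cone \<psi> (J - {j}) \<subseteq> gen_cone \<psi> (I \<inter> {i. f (\<psi> i) = 0})"
    using J(1) zero fin by (intro gen_cone_mono) auto
  ultimately have mI: "m \<in> gen_cone \<psi> (I \<inter> {i. f (\<psi> i) = 0})" by blast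
  have "I \<inter> {i. f (\<psi> i) < 0} = {}"
  proof (rule ccontr)
    assume "I \<inter> {i. f (\<psi> i) < 0} \<noteq> {}"
    then obtain k where k: "k \<in> I" "- f (\<psi> k) > 0" by auto
    have "b \<in> gen_cone \<psi> I"
      using gen_cone_crosses_wall[OF F crosses_wall_sym[OF cr] I _ k] mI by simp
    then show False using L by blast
  qed
  then show ?R using mI j(1) J(1) fj by blast
qed

text \<open>
  All vectors of \<open>flip A \<psi>\<close> lie on the closed side of \<open>b\<close>, so its cones never contain \<open>a\<close>, and
  the criterion \<open>gen_cone_crossing_iff\<close> decides which of them contain \<open>b\<close>.  Flipping does not change the
  vectors on the wall, so the condition on \<open>m\<close> is the same for both families.
\<close>

lemma wall_crossing_formula:
  fixes \<psi> :: "nat \<Rightarrow> 'a::euclidean_space"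
  assumes F: "subspace F" "\<psi> ` {1..N} \<subseteq> F" "span (\<psi> ` {1..N}) = F"
    and cr: "crosses_wall F N \<psi> f a b m" and B: "B \<subseteq> {1..N}"
    and A: "A = {i \<in> {1..N}. f (\<psi> i) > 0}"
  shows "(- 1) ^ card B * signed_count {1..N} (\<lambda>I. a \<in> gen_cone \<psi> I) B
    = (- 1) ^ card B * signed_count {1..N} (\<lambda>I. b \<in> gen_cone \<psi> I) B
      - (- 1) ^ card (sym_diff B A) * signed_count {1..N} (\<lambda>I. b \<in> gen_cone (flip A \<psi>) I) (sym_diff B A)"
proof -
  let ?\<psi>' = "flip A \<psi>"
  define U where "U = {i \<in> {1..N}. f (\<psi> i) = 0}"
  define V where "V = {i \<in> {1..N}. f (\<psi> i) < 0}"
  have UAV: "{1..N} = U \<union> A \<union> V" unfolding U_def V_def A by auto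
  have f: "linear f" "f a > 0" using cr by (auto simp: crosses_wall_def)
  have F': "?\<psi>' ` {1..N} \<subseteq> F" "span (?\<psi>' ` {1..N}) = F"
    using F(3) span_superset[of "?\<psi>' ` {1..N}"] by (auto simp only: span_flip)
  have cr': "crosses_wall F N ?\<psi>' f a b m" using cr by (simp add: crosses_wall_flip)
  have f': "f (?\<psi>' i) = (if i \<in> A then - f (\<psi> i) else f (\<psi> i))" for i
    by (simp add: flip_def linear_neg[OF f(1)])
  have neg: "f (?\<psi>' i) \<le> 0" if "i \<in> {1..N}" for i using that unfolding f' by (auto simp: A)
  have not_a: "a \<notin> gen_cone ?\<psi>' I" if I: "I \<subseteq> {1..N}" for I
  proof
    assume "a \<in> gen_cone ?\<psi>' I"
    then obtain t where t: "\<forall>i\<in>I. t i \<ge> 0" "a = (\<Sum>i\<in>I. t i *\<^sub>R ?\<psi>' i)" unfolding gen_cone_def by blast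
    have "f a = (\<Sum>i\<in>I. t i * f (?\<psi>' i))" unfolding t(2) by (simp add: linear_sum[OF f(1)] linear_scale[OF f(1)])
    also have "\<dots> \<le> 0" using t(1) neg I by (intro sum_nonpos mult_nonneg_nonpos) auto
    finally show False using f(2) by simp
  qed
  have sets: "I \<inter> {i. f (\<psi> i) = 0} = I \<inter> U" "I \<inter> {i. f (\<psi> i) > 0} = I \<inter> A"
      "I \<inter> {i. f (\<psi> i) < 0} = I \<inter> V" "I \<inter> {i. f (?\<psi>' i) = 0} = I \<inter> U"
      "I \<inter> {i. f (?\<psi>' i) > 0} = {}" "I \<inter> {i. f (?\<psi>' i) < 0} = I \<inter> (A \<union> V)"
    if "I \<subseteq> {1..N}" for I
    using that unfolding f' by (auto simp: U_def V_def A split: if_splits)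
  have cone_eq: "gen_cone ?\<psi>' (I \<inter> U) = gen_cone \<psi> (I \<inter> U)" for I
  proof -
    have "?\<psi>' i = \<psi> i" if "i \<in> I \<inter> U" for i using that by (auto simp: flip_def U_def A)
    then have "(\<Sum>i\<in>I \<inter> U. t i *\<^sub>R ?\<psi>' i) = (\<Sum>i\<in>I \<inter> U. t i *\<^sub>R \<psi> i)" for t
      by (intro sum.cong) simp_all
    then show ?thesis unfolding gen_cone_def by simp
  qed
  have fin: "finite U" "finite A" "finite V" by (simp_all add: U_def V_def A)
  have dis: "U \<inter> A = {}" "U \<inter> V = {}" "A \<inter> V = {}" by (auto simp: U_def V_def A)
  have BU: "B \<subseteq> U \<union> A \<union> V" using B UAV by simp
  show ?thesis unfolding UAV
  proof (rule signed_count_crossing[where R = "\<lambda>I. m \<in> gen_cone \<psi> I"])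
    fix I assume "I \<subseteq> U \<union> A \<union> V"
    then have I: "I \<subseteq> {1..N}" using UAV by simp
    show "a \<in> gen_cone \<psi> I \<and> b \<notin> gen_cone \<psi> I \<longleftrightarrow> m \<in> gen_cone \<psi> (I \<inter> U) \<and> I \<inter> A \<noteq> {} \<and> I \<inter> V = {}"
      using gen_cone_crossing_iff[OF F cr I] sets(1-3)[OF I] by simp
    show "b \<in> gen_cone \<psi> I \<and> a \<notin> gen_cone \<psi> I \<longleftrightarrow> m \<in> gen_cone \<psi> (I \<inter> U) \<and> I \<inter> V \<noteq> {} \<and> I \<inter> A = {}"
      using gen_cone_crossing_iff[OF F crosses_wall_sym[OF cr] I] sets(1-3)[OF I] by simp
    show "b \<in> gen_cone ?\<psi>' I \<longleftrightarrow> m \<in> gen_cone \<psi> (I \<inter> U) \<and> I \<inter> (A \<union> V) \<noteq> {}"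
      using gen_cone_crossing_iff[OF F(1) F' crosses_wall_sym[OF cr'] I] sets(4-6)[OF I] not_a[OF I] cone_eq
      by simp
  qed (use fin dis BU in simp_all)
qed

text \<open>
  After the flip no vector lies on the positive side of \<open>f\<close>.  A nonnegative relation
  therefore only involves vectors with \<open>f = 0\<close>, and these have not been flipped.
\<close>

lemma positively_independent_flip:
  fixes \<psi> :: "nat \<Rightarrow> 'a::real_vector" and f :: "'a \<Rightarrow> real"
  assumes S: "finite S" and pos: "positively_independent \<psi> S" and f: "linear f"
    and A: "A = {i \<in> S. f (\<psi> i) > 0}"
  shows "positively_independent (flip A \<psi>) S"
  unfolding positively_independent_def
proof (intro allI impI)
  let ?\<psi>' = "flip A \<psi>"
  fix t assume t: "(\<forall>i\<in>S. 0 \<le> t i) \<and> (\<Sum>i\<in>S. t i *\<^sub>R ?\<psi>' i) = 0"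
  have f': "f (?\<psi>' i) = (if i \<in> A then - f (\<psi> i) else f (\<psi> i))" for i
    by (simp add: flip_def linear_neg[OF f])
  have "f (?\<psi>' i) \<le> 0" if "i \<in> S" for i using that unfolding f' by (auto simp: A)
  then have le: "t i * f (?\<psi>' i) \<le> 0" if "i \<in> S" for i using t that by (intro mult_nonneg_nonpos) auto
  have "(\<Sum>i\<in>S. t i * f (?\<psi>' i)) = 0"
    using arg_cong[OF conjunct2[OF t], of f] by (simp add: linear_sum[OF f] linear_scale[OF f] linear_0[OF f])
  then have "(\<Sum>i\<in>S. - (t i * f (?\<psi>' i))) = 0" by (simp add: sum_negf)
  then have "\<forall>i\<in>S. - (t i * f (?\<psi>' i)) = 0" using S le by (subst (asm) sum_nonneg_eq_0_iff) auto
  then have z: "t i = 0 \<or> i \<notin> A" if "i \<in> S" for i using that f'[of i] A by auto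
  have "(\<Sum>i\<in>S. t i *\<^sub>R \<psi> i) = (\<Sum>i\<in>S. t i *\<^sub>R ?\<psi>' i)"
    using z by (intro sum.cong) (auto simp: flip_def)
  then show "\<forall>i\<in>S. t i = 0" using pos t unfolding positively_independent_def by simp
qed

section \<open>Adjacent topes\<close>

lemma tope_nonempty: "\<tau> \<in> topes F N \<psi> \<Longrightarrow> \<tau> \<noteq> {}"
  by (auto simp: topes_def dest: in_components_nonempty)

text \<open>
  If a functional of a wall \<open>V\<close> takes opposite signs on the two topes, then the intersection of
  their closures is contained in \<open>V\<close>, so that \<open>V\<close> is the common wall.  Conversely the common
  wall separates the topes, since otherwise a segment between them would consist of regular points
  and the topes would coincide.
\<close>

lemma adjacent_functional:
  fixes \<psi> :: "nat \<Rightarrow> 'a::euclidean_space"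
  assumes F: "subspace F" "\<psi> ` {1..N} \<subseteq> F"
    and \<tau>: "\<tau>1 \<in> topes F N \<psi>" "\<tau>2 \<in> topes F N \<psi>" and adj: "adjacent F N \<psi> \<tau>1 \<tau>2"
  shows "\<exists>f. (\<forall>a\<in>\<tau>1. \<forall>b\<in>\<tau>2. \<exists>m. crosses_wall F N \<psi> f a b m) \<and>
    side_indices F N \<psi> \<tau>1 \<tau>2 = {i \<in> {1..N}. f (\<psi> i) > 0}"
proof -
  obtain W where W: "W \<in> walls F N \<psi>" "closure \<tau>1 \<inter> closure \<tau>2 \<subseteq> W"
    "span (closure \<tau>1 \<inter> closure \<tau>2) = W"
    using adj by (auto simp: adjacent_def)
  have sub: "\<tau>1 \<subseteq> regular F N \<psi>" "\<tau>2 \<subseteq> regular F N \<psi>" using \<tau> by (simp_all add: tope_subset_regular)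
  have reg: "x \<notin> V" if "x \<in> \<tau>1 \<or> x \<in> \<tau>2" "V \<in> walls F N \<psi>" for x V
    using sub that unfolding regular_def by blast
  have \<tau>F: "\<tau>1 \<subseteq> F" "\<tau>2 \<subseteq> F" using sub unfolding regular_def by blast+
  obtain a0 where a0: "a0 \<in> \<tau>1" using tope_nonempty[OF \<tau>(1)] by blast
  obtain f0 :: "'a \<Rightarrow> real" where f0: "linear f0" "W = {x \<in> F. f0 x = 0}"
    by (rule wall_functional[OF W(1) F])
  have "a0 \<notin> W" "a0 \<in> F" using reg[of a0 W] a0 W(1) \<tau>F by blast+
  then have "f0 a0 \<noteq> 0" unfolding f0(2) by simp
  then have "\<exists>f :: 'a \<Rightarrow> real. linear f \<and> W = {x \<in> F. f x = 0} \<and> f a0 > 0"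
  proof (cases "f0 a0 > 0")
    case False
    then show ?thesis using \<open>f0 a0 \<noteq> 0\<close> f0 linear_compose_neg[OF f0(1)] by (intro exI[of _ "\<lambda>x. - f0 x"]) auto
  qed (use f0 in blast)
  then obtain f :: "'a \<Rightarrow> real" where f: "linear f" "W = {x \<in> F. f x = 0}" "f a0 > 0" by blast
  have wall: "{x \<in> F. f x = 0} \<in> walls F N \<psi>" using W(1) f(2) by simp
  have pos: "f a > 0" if "a \<in> \<tau>1" for a by (rule tope_same_sign[OF \<tau>(1) f(1) wall a0 that f(3)])
  have apart: "V = W"
    if V: "V = {x \<in> F. g x = 0}" "V \<in> walls F N \<psi>" and g: "linear g" "g a > 0"
      and ab: "a \<in> \<tau>1" "b \<in> \<tau>2" and c: "c \<in> closed_segment a b" "c \<in> V"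
    for V a b c and g :: "'a \<Rightarrow> real"
  proof -
    have Vg: "{x \<in> F. g x = 0} \<in> walls F N \<psi>" "{x \<in> F. - g x = 0} \<in> walls F N \<psi>" using V by simp_all
    have lin: "linear (\<lambda>x. - g x)" by (rule linear_compose_neg[OF g(1)])
    have "\<not> g b > 0" using linear_pos_on_segment[OF g _ c(1)] c(2) unfolding V(1) by auto
    moreover have "g b \<noteq> 0" using reg[of b V] ab V \<tau>F by blast
    ultimately have b: "- g b > 0" by simp
    have 1: "g x > 0" if "x \<in> \<tau>1" for x by (rule tope_same_sign[OF \<tau>(1) g(1) Vg(1) ab(1) that g(2)])
    have 2: "- g x > 0" if "x \<in> \<tau>2" for x by (rule tope_same_sign[OF \<tau>(2) lin Vg(2) ab(2) that b])
    have cont: "continuous_on UNIV g" using g(1) by (simp add: linear_continuous_on linear_conv_bounded_linear)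
    have "closure \<tau>1 \<subseteq> {x. 0 \<le> g x}"
      using 1 by (intro closure_minimal closed_Collect_le cont continuous_on_const) (auto intro: less_imp_le)
    moreover have "closure \<tau>2 \<subseteq> {x. g x \<le> 0}"
      using 2 by (intro closure_minimal closed_Collect_le cont continuous_on_const) (auto intro: less_imp_le)
    moreover have "closure \<tau>1 \<subseteq> F" using \<tau>F(1) closed_subspace[OF F(1)] by (rule closure_minimal)
    ultimately have "closure \<tau>1 \<inter> closure \<tau>2 \<subseteq> V" using V(1) by fastforce
    then have "W \<subseteq> V" unfolding W(3)[symmetric] using wallsD(1)[OF V(2) F] by (rule span_minimal)
    moreover have "dim V \<le> dim W" using wallsD(3)[OF V(2) F] wallsD(3)[OF W(1) F] by simp
    ultimately show "V = W"
      using subspace_dim_equal[OF wallsD(1)[OF W(1) F] wallsD(1)[OF V(2) F]] by simp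
  qed
  have other: "closed_segment a b \<inter> V = {}" if V: "V \<in> walls F N \<psi>" "V \<noteq> W" and ab: "a \<in> \<tau>1" "b \<in> \<tau>2" for V a b
  proof (rule ccontr)
    assume "closed_segment a b \<inter> V \<noteq> {}"
    then obtain c where c: "c \<in> closed_segment a b" "c \<in> V" by blast
    obtain g :: "'a \<Rightarrow> real" where g: "linear g" "V = {x \<in> F. g x = 0}"
      by (rule wall_functional[OF V(1) F])
    have "g a \<noteq> 0" using reg[of a V] ab V(1) g(2) \<tau>F by blast
    then consider "g a > 0" | "- g a > 0" by linarith
    then have "V = W"
    proof cases
      case 1
      show ?thesis by (rule apart[OF g(2) V(1) g(1) 1 ab c])
    next
      case 2
      have "V = {x \<in> F. - g x = 0}" using g(2) by simp
      then show ?thesis by (rule apart[OF _ V(1) linear_compose_neg[OF g(1)] 2 ab c])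
    qed
    then show False using V(2) by simp
  qed
  have neg: "f b < 0" if b: "b \<in> \<tau>2" for b
  proof (rule ccontr)
    assume "\<not> f b < 0"
    moreover have "f b \<noteq> 0" using reg[of b W] b W(1) f(2) \<tau>F by blast
    ultimately have fb: "f b > 0" by simp
    have "c \<notin> V" if c: "c \<in> closed_segment a0 b" and V: "V \<in> walls F N \<psi>" for c V
    proof (cases "V = W")
      case True
      then show ?thesis using linear_pos_on_segment[OF f(1) f(3) fb c] f(2) by simp
    next
      case False
      then show ?thesis using other[OF V False a0 b] c by blast
    qed
    moreover have "closed_segment a0 b \<subseteq> F"
      using F(1) \<tau>F a0 b by (intro closed_segment_subset_subspace) auto
    ultimately have "closed_segment a0 b \<subseteq> regular F N \<psi>" by (auto simp: regular_def)
    then have "\<tau>1 = \<tau>2" by (rule topes_eq_if_segment_regular[OF \<tau> a0 b])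
    then have "a0 \<in> W" using W(2) a0 closure_subset[of \<tau>1] by blast
    then show False using reg[of a0 W] a0 W(1) by blast
  qed
  have "\<exists>m. crosses_wall F N \<psi> f a b m" if ab: "a \<in> \<tau>1" "b \<in> \<tau>2" for a b
  proof -
    have "\<exists>m\<in>closed_segment a b. f m = 0"
      by (rule linear_zero_on_segment[OF f(1) less_imp_le[OF pos[OF ab(1)]] neg[OF ab(2)]])
    moreover have "a \<in> F" "b \<in> F" using ab \<tau>F by auto
    moreover have "closed_segment a b \<inter> V = {}" if "V \<in> walls F N \<psi>" "V \<noteq> {x \<in> F. f x = 0}" for V
      using other[OF _ _ ab] that f(2) by blast
    ultimately show ?thesis
      unfolding crosses_wall_def using f(1) wall pos[OF ab(1)] neg[OF ab(2)] by blast
  qed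
  moreover have "(\<exists>H. open_side F W H \<and> \<tau>1 \<subseteq> H \<and> x \<in> H) \<longleftrightarrow> f x > 0" if x: "x \<in> F" for x
  proof
    assume "f x > 0"
    have "open_side F W {x \<in> F. f x > 0}" unfolding open_side_def using f(1,2) by blast
    moreover have "\<tau>1 \<subseteq> {x \<in> F. f x > 0}" using pos \<tau>F by blast
    ultimately show "\<exists>H. open_side F W H \<and> \<tau>1 \<subseteq> H \<and> x \<in> H" using x \<open>f x > 0\<close> by blast
  next
    assume "\<exists>H. open_side F W H \<and> \<tau>1 \<subseteq> H \<and> x \<in> H"
    then obtain H where H: "open_side F W H" "\<tau>1 \<subseteq> H" "x \<in> H" by blast
    obtain g :: "'a \<Rightarrow> real" where g: "linear g" "W = {x \<in> F. g x = 0}" "H = {x \<in> F. g x > 0}"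
      using H(1) unfolding open_side_def by blast
    have gp: "g x > 0" "g a0 > 0" using H(2,3) a0 g(3) by auto
    \<comment> \<open>\<open>f\<close> and \<open>g\<close> have the same kernel in \<open>F\<close>, so they are proportional there\<close>
    let ?y = "x - (g x / g a0) *\<^sub>R a0"
    have "a0 \<in> F" using a0 \<tau>F by blast
    then have "?y \<in> F" using F(1) x by (intro subspace_diff subspace_scale)
    moreover have "g ?y = 0" using gp by (simp add: linear_diff[OF g(1)] linear_scale[OF g(1)])
    ultimately have "f ?y = 0" using g(2) f(2) by blast
    then have "f x = (g x / g a0) * f a0" by (simp add: linear_diff[OF f(1)] linear_scale[OF f(1)])
    then show "f x > 0" using gp f(3) by simp
  qed
  then have "side_indices F N \<psi> \<tau>1 \<tau>2 = {i \<in> {1..N}. f (\<psi> i) > 0}"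
    unfolding side_indices_def common_wall_def W(3) using F(2) by blast
  ultimately show ?thesis by blast
qed

section \<open>Salient cones\<close>

text \<open>
  If \<open>\<psi> k\<close> has a positive coefficient in a nonnegative relation, then adding a multiple of the
  relation to \<open>s *\<^sub>R \<psi> k\<close> shows that the whole line through \<open>\<psi> k\<close> is contained in the cone.
\<close>

lemma positively_independent_if_salient:
  fixes \<psi> :: "nat \<Rightarrow> 'a::real_vector"
  assumes I: "finite I" "\<forall>i\<in>I. \<psi> i \<noteq> 0" and sal: "salient (gen_cone \<psi> I)"
  shows "positively_independent \<psi> I"
  unfolding positively_independent_def
proof (intro allI impI ballI, rule ccontr)
  fix t k assume t: "(\<forall>i\<in>I. 0 \<le> t i) \<and> (\<Sum>i\<in>I. t i *\<^sub>R \<psi> i) = 0" and k: "k \<in> I" "t k \<noteq> 0"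
  have tk: "t k > 0" using t k by force
  have "0 + s *\<^sub>R \<psi> k \<in> gen_cone \<psi> I" for s
  proof (rule gen_coneI)
    \<comment> \<open>this multiple of the relation contributes \<open>\<bar>s\<bar>\<close> to the coefficient of \<open>\<psi> k\<close>\<close>
    let ?c = "\<lambda>i. \<bar>s\<bar> / t k * t i + (if i = k then s else 0)"
    show "?c i \<ge> 0" if "i \<in> I" for i
    proof (cases "i = k")
      case True
      then show ?thesis using tk by simp
    next
      case False
      then show ?thesis using t tk that by simp
    qed
    have "(\<Sum>i\<in>I. ?c i *\<^sub>R \<psi> i) = (\<bar>s\<bar> / t k) *\<^sub>R (\<Sum>i\<in>I. t i *\<^sub>R \<psi> i) + (\<Sum>i\<in>I. if i = k then s *\<^sub>R \<psi> i else 0)"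
      unfolding scaleR_sum_right sum.distrib[symmetric] by (rule sum.cong) (auto simp: scaleR_left_distrib)
    then show "0 + s *\<^sub>R \<psi> k = (\<Sum>i\<in>I. ?c i *\<^sub>R \<psi> i)" using t k(1) I(1) by simp
  qed
  then show False using sal I(2) k(1) unfolding salient_def by blast
qed

text \<open>
  The convex hull of the vectors is compact and does not contain \<open>0\<close>, so some functional \<open>n\<close> is
  bounded below by a positive number on the vectors.  A line in the cone has to be parallel to the
  kernel of \<open>n\<close>, while the part of the cone where \<open>n\<close> has a given value is bounded.
\<close>

lemma salient_if_positively_independent:
  fixes \<psi> :: "nat \<Rightarrow> 'a::euclidean_space"
  assumes I: "finite I" and pos: "positively_independent \<psi> I"
  shows "salient (gen_cone \<psi> I)"
  unfolding salient_def
proof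
  define C where "C = {\<Sum>i\<in>I. t i *\<^sub>R \<psi> i | t. (\<forall>i\<in>I. t i \<ge> 0) \<and> sum t I = 1}"
  have "convex C"
  proof (rule convexI)
    fix x y and u v :: real
    assume xy: "x \<in> C" "y \<in> C" and uv: "0 \<le> u" "0 \<le> v" "u + v = 1"
    obtain s where s: "x = (\<Sum>i\<in>I. s i *\<^sub>R \<psi> i)" "\<forall>i\<in>I. s i \<ge> 0" "sum s I = 1"
      using xy(1) unfolding C_def mem_Collect_eq by (elim exE conjE)
    obtain t where t: "y = (\<Sum>i\<in>I. t i *\<^sub>R \<psi> i)" "\<forall>i\<in>I. t i \<ge> 0" "sum t I = 1"
      using xy(2) unfolding C_def mem_Collect_eq by (elim exE conjE)
    have "u *\<^sub>R x + v *\<^sub>R y = (\<Sum>i\<in>I. (u * s i + v * t i) *\<^sub>R \<psi> i)"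
      by (simp add: s(1) t(1) scaleR_sum_right scaleR_left_distrib sum.distrib)
    moreover have "(\<Sum>i\<in>I. u * s i + v * t i) = 1"
      using uv(3) s(3) t(3) by (simp add: sum.distrib flip: sum_distrib_left)
    moreover have "\<forall>i\<in>I. u * s i + v * t i \<ge> 0" using uv s(2) t(2) by simp
    ultimately show "u *\<^sub>R x + v *\<^sub>R y \<in> C"
      unfolding C_def by (intro CollectI exI[of _ "\<lambda>i. u * s i + v * t i"] conjI)
  qed
  moreover have "\<psi> ` I \<subseteq> C"
  proof
    fix x assume "x \<in> \<psi> ` I"
    then obtain k where k: "k \<in> I" "x = \<psi> k" by blast
    have "x = (\<Sum>i\<in>I. of_bool (i = k) *\<^sub>R \<psi> i)"
      using k I by (simp add: of_bool_def if_distrib[of "\<lambda>c. c *\<^sub>R _"] cong: if_cong)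
    moreover have "(\<Sum>i\<in>I. of_bool (i = k)) = (1::real)" using k I by (simp add: of_bool_def)
    ultimately show "x \<in> C" unfolding C_def by (intro CollectI exI[of _ "\<lambda>i. of_bool (i = k)"]) simp
  qed
  ultimately have hull: "convex hull (\<psi> ` I) \<subseteq> C" by (intro hull_minimal)
  have "0 \<notin> C"
  proof
    assume "0 \<in> C"
    then obtain t where t: "0 = (\<Sum>i\<in>I. t i *\<^sub>R \<psi> i)" "\<forall>i\<in>I. t i \<ge> 0" "sum t I = 1"
      unfolding C_def mem_Collect_eq by (elim exE conjE)
    then have "\<forall>i\<in>I. t i = 0" using pos unfolding positively_independent_def by simp
    then show False using t(3) by simp
  qed
  then have "0 \<notin> convex hull (\<psi> ` I)" using hull by blast
  moreover have "closed (convex hull (\<psi> ` I))"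
    using I by (intro compact_imp_closed finite_imp_compact_convex_hull) simp
  ultimately obtain n b where n: "0 < b" "\<forall>x\<in>convex hull (\<psi> ` I). n \<bullet> x > b"
    using separating_hyperplane_closed_0[OF convex_convex_hull, of "\<psi> ` I"] by blast
  have npos: "n \<bullet> \<psi> i > b" if "i \<in> I" for i using n(2) hull_inc[of "\<psi> i" "\<psi> ` I" convex] that by blast
  assume "\<exists>x v. v \<noteq> 0 \<and> (\<forall>s::real. x + s *\<^sub>R v \<in> gen_cone \<psi> I)"
  then obtain x v where v: "v \<noteq> 0" "\<And>s::real. x + s *\<^sub>R v \<in> gen_cone \<psi> I" by blast
  define M where "M = (\<Sum>i\<in>I. norm (\<psi> i))"
  have "\<exists>q\<ge>0. n \<bullet> (x + s *\<^sub>R v) \<ge> b * q \<and> norm (x + s *\<^sub>R v) \<le> q * M" for s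
  proof -
    obtain t where t: "\<forall>i\<in>I. t i \<ge> 0" "x + s *\<^sub>R v = (\<Sum>i\<in>I. t i *\<^sub>R \<psi> i)"
      using v(2)[of s] unfolding gen_cone_def by blast
    have "b * t i \<le> t i * (n \<bullet> \<psi> i)" if "i \<in> I" for i
      using mult_left_mono[OF less_imp_le[OF npos[OF that]], of "t i"] t(1) that by (simp add: mult.commute)
    then have "b * sum t I \<le> (\<Sum>i\<in>I. t i * (n \<bullet> \<psi> i))"
      unfolding sum_distrib_left by (rule sum_mono)
    then have 1: "n \<bullet> (x + s *\<^sub>R v) \<ge> b * sum t I" unfolding t(2) by (simp add: inner_sum_right)
    have "norm (x + s *\<^sub>R v) \<le> (\<Sum>i\<in>I. t i * norm (\<psi> i))"
      unfolding t(2) by (rule order_trans[OF norm_sum]) (use t(1) in simp)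
    also have "\<dots> \<le> (\<Sum>i\<in>I. t i * M)"
      unfolding M_def using t(1) I by (intro sum_mono mult_left_mono member_le_sum) auto
    finally have "norm (x + s *\<^sub>R v) \<le> sum t I * M" by (simp add: sum_distrib_right)
    then show ?thesis using 1 t(1) by (intro exI[of _ "sum t I"]) (auto intro: sum_nonneg)
  qed
  then have "\<exists>q. \<forall>s. q s \<ge> 0 \<and> n \<bullet> (x + s *\<^sub>R v) \<ge> b * q s \<and> norm (x + s *\<^sub>R v) \<le> q s * M"
    by (intro choice) blast
  then obtain q where q: "\<And>s. q s \<ge> 0" "\<And>s. n \<bullet> (x + s *\<^sub>R v) \<ge> b * q s"
      "\<And>s. norm (x + s *\<^sub>R v) \<le> q s * M" by blast
  have nv: "n \<bullet> v = 0"
  proof (rule ccontr)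
    assume nz: "n \<bullet> v \<noteq> 0"
    \<comment> \<open>at this parameter \<open>n\<close> would be negative on a point of the cone\<close>
    have "n \<bullet> (x + ((- 1 - n \<bullet> x) / (n \<bullet> v)) *\<^sub>R v) = - 1" using nz by (simp add: inner_right_distrib)
    moreover have "b * q ((- 1 - n \<bullet> x) / (n \<bullet> v)) \<ge> 0" using q(1) n(1) by simp
    ultimately show False using q(2)[of "(- 1 - n \<bullet> x) / (n \<bullet> v)"] by linarith
  qed
  have "M \<ge> 0" unfolding M_def by (rule sum_nonneg) simp
  have bound: "\<bar>s\<bar> * norm v \<le> (n \<bullet> x) / b * M + norm x" for s
  proof -
    have "q s \<le> (n \<bullet> x) / b" using q(2)[of s] n(1) by (simp add: inner_right_distrib nv pos_le_divide_eq mult.commute)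
    then have "q s * M \<le> (n \<bullet> x) / b * M" using \<open>M \<ge> 0\<close> by (rule mult_right_mono)
    moreover have "norm (s *\<^sub>R v) \<le> norm (x + s *\<^sub>R v) + norm x"
      using norm_triangle_ineq4[of "x + s *\<^sub>R v" x] by simp
    ultimately show ?thesis using q(3)[of s] by simp
  qed
  define K where "K = (n \<bullet> x) / b * M + norm x"
  have "K \<ge> 0" using bound[of 0] by (simp add: K_def)
  then have "\<bar>(K + 1) / norm v\<bar> * norm v = K + 1" using v(1) by simp
  then show False using bound[of "(K + 1) / norm v"] by (simp add: K_def)
qed

section \<open>The coefficients of the Combinatorial Brianchon-Gram polynomial\<close>

definition pq_monomial :: "nat \<Rightarrow> nat set \<Rightarrow> var \<Rightarrow>\<^sub>0 nat" where
  "pq_monomial N B = (\<Sum>i\<in>{1..N} - B. Poly_Mapping.single (P i) 1) + (\<Sum>i\<in>B. Poly_Mapping.single (Q i) 1)"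

lemma prod_single:
  "finite A \<Longrightarrow> (\<Prod>i\<in>A. Poly_Mapping.single (k i) (1 :: 'b :: comm_semiring_1)) = Poly_Mapping.single (\<Sum>i\<in>A. k i) 1"
  for k :: "nat \<Rightarrow> 'c :: comm_monoid_add"
  by (induction A rule: finite_induct) (simp_all add: mult_single)

lemma pq_monomial_single:
  assumes "B \<subseteq> {1..N}"
  shows "of_int z * (\<Prod>i\<in>{1..N} - B. pvar i) * (\<Prod>i\<in>B. qvar i) = Poly_Mapping.single (pq_monomial N B) z"
proof -
  have "finite B" using assms finite_subset by blast
  then have "of_int z * (\<Prod>i\<in>{1..N} - B. pvar i) * (\<Prod>i\<in>B. qvar i)
      = Poly_Mapping.single 0 z * Poly_Mapping.single (\<Sum>i\<in>{1..N} - B. Poly_Mapping.single (P i) 1) 1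
        * Poly_Mapping.single (\<Sum>i\<in>B. Poly_Mapping.single (Q i) 1) 1"
    by (simp add: pvar_def qvar_def prod_single flip: single_of_int)
  then show ?thesis by (simp add: mult_single pq_monomial_def)
qed

lemma pq_monomial_inj:
  assumes "pq_monomial N B = pq_monomial N C" "B \<subseteq> {1..N}" "C \<subseteq> {1..N}"
  shows "B = C"
proof -
  have "Poly_Mapping.lookup (pq_monomial N B) (Q j) = of_bool (j \<in> B)" if "B \<subseteq> {1..N}" for B j
  proof -
    have "finite B" using that finite_subset by blast
    then show ?thesis
      by (auto simp: pq_monomial_def lookup_add lookup_sum lookup_single when_def)
  qed
  from this[OF assms(2)] this[OF assms(3)] assms(1) have "of_bool (j \<in> B) = (of_bool (j \<in> C) :: nat)" for j
    by metis
  then have "j \<in> B \<longleftrightarrow> j \<in> C" for j by (simp only: of_bool_eq_iff)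
  then show ?thesis by blast
qed

text \<open>
  Membership in the cones is constant on a tope, and general position makes the generation of
  \<open>F\<close> automatic.  So any single point of the tope determines the polynomial.
\<close>

lemma tope_gen_sets:
  fixes \<psi> :: "nat \<Rightarrow> 'a::euclidean_space"
  assumes F: "subspace F" "\<psi> ` {1..N} \<subseteq> F" "span (\<psi> ` {1..N}) = F"
    and a: "\<tau> \<in> topes F N \<psi>" "a \<in> \<tau>"
  shows "gen_sets F N \<psi> \<tau> = {I. I \<subseteq> {1..N} \<and> a \<in> gen_cone \<psi> I}"
proof (intro set_eqI iffI)
  fix I assume "I \<in> gen_sets F N \<psi> \<tau>"
  then show "I \<in> {I. I \<subseteq> {1..N} \<and> a \<in> gen_cone \<psi> I}" using a(2) by (auto simp: gen_sets_def)
next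
  fix I assume "I \<in> {I. I \<subseteq> {1..N} \<and> a \<in> gen_cone \<psi> I}"
  then have I: "I \<subseteq> {1..N}" "a \<in> gen_cone \<psi> I" by auto
  have "b \<in> gen_cone \<psi> I" if b: "b \<in> \<tau>" for b
  proof (rule gen_cone_const_on_segment[OF finite_atLeastAtMost F(2) _ I])
    fix c assume "c \<in> closed_segment a b"
    then have "c \<in> regular F N \<psi>" using tope_segment_regular[OF F(1,2) a b] by blast
    then show "general_position F \<psi> {1..N} c" by (rule regular_general_position[OF F(1,3)])
  qed
  moreover have "span (\<psi> ` I) = F"
  proof (rule general_position_span[OF _ I(1)])
    show "general_position F \<psi> {1..N} a"
      using tope_subset_regular[OF a(1)] a(2) by (intro regular_general_position[OF F(1,3)]) auto
    show "a \<in> span (\<psi> ` I)" using I(2) gen_cone_subset_span[of \<psi> I] by blast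
  qed
  ultimately show "I \<in> gen_sets F N \<psi> \<tau>" using I(1) by (auto simp: gen_sets_def)
qed

text \<open>
  Expand \<open>(\<Prod>i\<in>I. pvar i + qvar i)\<close> over the subsets \<open>B\<close> of \<open>I\<close> and exchange the two sums.
\<close>

lemma BG_poly_expansion:
  fixes \<psi> :: "nat \<Rightarrow> 'a::euclidean_space"
  assumes F: "subspace F" "\<psi> ` {1..N} \<subseteq> F" "span (\<psi> ` {1..N}) = F"
    and a: "\<tau> \<in> topes F N \<psi>" "a \<in> \<tau>"
  shows "BG_poly F N \<psi> \<tau> = (\<Sum>B\<in>Pow {1..N}.
    of_int ((- 1) ^ dim F * signed_count {1..N} (\<lambda>I. a \<in> gen_cone \<psi> I) B)
      * (\<Prod>i\<in>{1..N} - B. pvar i) * (\<Prod>i\<in>B. qvar i))"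
proof -
  let ?G = "gen_sets F N \<psi> \<tau>"
  define mon where "mon B = (\<Prod>i\<in>{1..N} - B. pvar i) * (\<Prod>i\<in>B. qvar i)" for B
  note G = tope_gen_sets[OF F a]
  have "(- 1) ^ (card I - dim F) * (\<Prod>i\<in>{1..N} - I. pvar i) * (\<Prod>i\<in>I. pvar i + qvar i)
      = (\<Sum>B\<in>Pow {1..N}. of_int ((- 1) ^ dim F * (of_bool (B \<subseteq> I) * (- 1) ^ card I)) * mon B)"
    if I: "I \<in> ?G" for I
  proof -
    have IN: "I \<subseteq> {1..N}" "span (\<psi> ` I) = F" using I by (auto simp: gen_sets_def)
    then have fin: "finite I" using finite_subset by blast
    have "dim F = dim (\<psi> ` I)" using IN(2) by (metis dim_span)
    also have "\<dots> \<le> card (\<psi> ` I)" using fin by (simp add: dim_le_card')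
    also have "\<dots> \<le> card I" using fin by (rule card_image_le)
    finally have "card I = (card I - dim F) + dim F" by simp
    then have "(- 1) ^ card I = ((- 1) ^ (card I - dim F) * (- 1) ^ dim F :: int)"
      by (metis power_add)
    then have sign: "(- 1) ^ dim F * (- 1) ^ card I = ((- 1) ^ (card I - dim F) :: int)"
      by (simp add: mult.left_commute flip: power_mult_distrib)
    have "(\<Prod>i\<in>{1..N} - I. pvar i) * (\<Prod>i\<in>I. pvar i + qvar i)
        = (\<Prod>i\<in>{1..N} - I. pvar i) * (\<Sum>B\<in>Pow I. (\<Prod>i\<in>B. qvar i) * (\<Prod>i\<in>I - B. pvar i))"
      using prod_add[OF fin, of qvar pvar] by (simp add: add.commute)
    also have "\<dots> = (\<Sum>B\<in>Pow I. mon B)"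
      unfolding sum_distrib_left
    proof (rule sum.cong[OF refl])
      fix B assume B: "B \<in> Pow I"
      have "{1..N} - B = ({1..N} - I) \<union> (I - B)" using IN(1) B by auto
      then have "(\<Prod>i\<in>{1..N} - B. pvar i) = (\<Prod>i\<in>{1..N} - I. pvar i) * (\<Prod>i\<in>I - B. pvar i)"
        using fin by (simp only:) (intro prod.union_disjoint, auto)
      then show "(\<Prod>i\<in>{1..N} - I. pvar i) * ((\<Prod>i\<in>B. qvar i) * (\<Prod>i\<in>I - B. pvar i)) = mon B"
        by (simp add: mon_def ac_simps)
    qed
    also have "\<dots> = (\<Sum>B\<in>Pow {1..N}. of_bool (B \<subseteq> I) * mon B)"
      using IN(1) by (intro sum.mono_neutral_cong_left) auto
    finally have *: "(\<Prod>i\<in>{1..N} - I. pvar i) * (\<Prod>i\<in>I. pvar i + qvar i)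
        = (\<Sum>B\<in>Pow {1..N}. of_bool (B \<subseteq> I) * mon B)" .
    have "(- 1) ^ (card I - dim F) * (\<Prod>i\<in>{1..N} - I. pvar i) * (\<Prod>i\<in>I. pvar i + qvar i)
        = (\<Sum>B\<in>Pow {1..N}. (- 1) ^ (card I - dim F) * (of_bool (B \<subseteq> I) * mon B))"
      unfolding mult.assoc * sum_distrib_left ..
    also have "\<dots> = (\<Sum>B\<in>Pow {1..N}. of_int ((- 1) ^ dim F * (of_bool (B \<subseteq> I) * (- 1) ^ card I)) * mon B)"
    proof (rule sum.cong[OF refl])
      fix B
      have "of_int ((- 1) ^ dim F * (of_bool (B \<subseteq> I) * (- 1) ^ card I))
          = (of_int ((- 1) ^ (card I - dim F) * of_bool (B \<subseteq> I)) :: pq_poly)"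
        using sign by (cases "B \<subseteq> I") (simp_all only: of_bool_eq mult_1 mult_1_right mult_zero_left mult_zero_right)
      then show "(- 1) ^ (card I - dim F) * (of_bool (B \<subseteq> I) * mon B)
          = of_int ((- 1) ^ dim F * (of_bool (B \<subseteq> I) * (- 1) ^ card I)) * mon B"
        by (simp add: mult.assoc)
    qed
    finally show ?thesis .
  qed
  then have "BG_poly F N \<psi> \<tau>
      = (\<Sum>I\<in>?G. \<Sum>B\<in>Pow {1..N}. of_int ((- 1) ^ dim F * (of_bool (B \<subseteq> I) * (- 1) ^ card I)) * mon B)"
    unfolding BG_poly_def by (rule sum.cong[OF refl])
  also have "\<dots> = (\<Sum>B\<in>Pow {1..N}. \<Sum>I\<in>?G. of_int ((- 1) ^ dim F * (of_bool (B \<subseteq> I) * (- 1) ^ card I)) * mon B)"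
    by (rule sum.swap)
  also have "\<dots> = (\<Sum>B\<in>Pow {1..N}. of_int ((- 1) ^ dim F * signed_count {1..N} (\<lambda>I. a \<in> gen_cone \<psi> I) B) * mon B)"
  proof (rule sum.cong[OF refl])
    fix B
    have "signed_count {1..N} (\<lambda>I. a \<in> gen_cone \<psi> I) B = (\<Sum>I\<in>?G. of_bool (B \<subseteq> I) * (- 1) ^ card I)"
      unfolding signed_count_def G by (intro sum.mono_neutral_cong_right) auto
    then show "(\<Sum>I\<in>?G. of_int ((- 1) ^ dim F * (of_bool (B \<subseteq> I) * (- 1) ^ card I)) * mon B)
        = of_int ((- 1) ^ dim F * signed_count {1..N} (\<lambda>I. a \<in> gen_cone \<psi> I) B) * mon B"
      by (simp only: sum_distrib_left of_int_sum sum_distrib_right)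
  qed
  finally show ?thesis by (simp add: mon_def mult.assoc)
qed

lemma z_coeff_eq:
  fixes \<psi> :: "nat \<Rightarrow> 'a::euclidean_space"
  assumes F: "subspace F" "\<psi> ` {1..N} \<subseteq> F" "span (\<psi> ` {1..N}) = F"
    and a: "\<tau> \<in> topes F N \<psi>" "a \<in> \<tau>" and B: "B \<subseteq> {1..N}"
  shows "z_coeff F N \<psi> \<tau> B = (- 1) ^ dim F * signed_count {1..N} (\<lambda>I. a \<in> gen_cone \<psi> I) B"
proof -
  define z where "z C = (- 1) ^ dim F * signed_count {1..N} (\<lambda>I. a \<in> gen_cone \<psi> I) C" for C
  have "BG_poly F N \<psi> \<tau> = (\<Sum>C\<in>Pow {1..N}. Poly_Mapping.single (pq_monomial N C) (z C))"
    unfolding BG_poly_expansion[OF F a] z_def[symmetric] by (intro sum.cong pq_monomial_single) auto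
  then have "z_coeff F N \<psi> \<tau> B
      = (\<Sum>C\<in>Pow {1..N}. Poly_Mapping.lookup (Poly_Mapping.single (pq_monomial N C) (z C)) (pq_monomial N B))"
    unfolding z_coeff_def pq_monomial_def[symmetric] by (simp only: lookup_sum)
  also have "\<dots> = (\<Sum>C\<in>Pow {1..N}. if C = B then z C else 0)"
  proof (rule sum.cong[OF refl])
    fix C assume "C \<in> Pow {1..N}"
    then have "pq_monomial N C = pq_monomial N B \<longleftrightarrow> C = B" using pq_monomial_inj[of N C B] B by blast
    then show "Poly_Mapping.lookup (Poly_Mapping.single (pq_monomial N C) (z C)) (pq_monomial N B)
        = (if C = B then z C else 0)"
      by (simp add: lookup_single when_def)
  qed
  also have "\<dots> = z B" using B by simp
  finally show ?thesis by (simp add: z_def)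
qed

section \<open>Expansion along a path of topes\<close>

lemma flip_flip: "flip C (flip A \<psi>) = flip (sym_diff A C) \<psi>"
  by (auto simp: flip_def fun_eq_iff)

definition flip_step ::
    "'a::euclidean_space set \<Rightarrow> nat \<Rightarrow> (nat \<Rightarrow> 'a) \<Rightarrow> (nat \<Rightarrow> 'a set) \<Rightarrow> nat set \<Rightarrow> nat \<Rightarrow> nat set" where
  "flip_step F N \<psi> T A k = sym_diff A (side_indices F N (flip A \<psi>) (T k) (T (Suc k)))"

lemma flip_set_eq_foldl: "flip_set F N \<psi> T K = foldl (flip_step F N \<psi> T) {} K"
  by (simp add: flip_set_def flip_step_def[abs_def])

text \<open>
  At each wall the formula \<open>wall_crossing_formula\<close> offers the choice between keeping the family
  and flipping it; the choices correspond to the subsequences \<open>K\<close>.  The statement starts at an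
  arbitrary \<open>k\<close> and an arbitrary flipped family because the induction shortens the path at its
  beginning, just as the fold processes \<open>K\<close> from its first element.
\<close>

lemma path_expansion:
  fixes \<psi> :: "nat \<Rightarrow> 'a::euclidean_space" and pt :: "nat \<Rightarrow> 'a"
  assumes F: "subspace F" "\<psi> ` {1..N} \<subseteq> F" "span (\<psi> ` {1..N}) = F"
    and T: "\<And>j. \<lbrakk>1 \<le> j; j \<le> l\<rbrakk> \<Longrightarrow> T j \<in> topes F N \<psi>" "\<And>j. \<lbrakk>1 \<le> j; j < l\<rbrakk> \<Longrightarrow> adjacent F N \<psi> (T j) (T (Suc j))"
    and pt: "\<And>j. \<lbrakk>1 \<le> j; j \<le> l\<rbrakk> \<Longrightarrow> pt j \<in> T j" and B: "B \<subseteq> {1..N}"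
    and k: "1 \<le> k" "k \<le> l" and A: "A \<subseteq> {1..N}" "positively_independent (flip A \<psi>) {1..N}"
  defines "w \<equiv> \<lambda>C j. (- 1) ^ card (sym_diff B C)
      * signed_count {1..N} (\<lambda>I. pt j \<in> gen_cone (flip C \<psi>) I) (sym_diff B C)"
    and "step \<equiv> flip_step F N \<psi> T"
  shows "w A k = (\<Sum>K\<leftarrow>subseqs [k..<l]. (- 1) ^ length K * w (foldl step A K) l) \<and>
    (\<forall>K\<in>set (subseqs [k..<l]). foldl step A K \<subseteq> {1..N}
      \<and> positively_independent (flip (foldl step A K) \<psi>) {1..N})"
  using k(2,1) A
proof (induction k arbitrary: A rule: inc_induct)
  case base
  then show ?case by simp
next
  case (step k A)
  let ?\<psi> = "flip A \<psi>"
  define C where "C = side_indices F N ?\<psi> (T k) (T (Suc k))"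
  have F': "?\<psi> ` {1..N} \<subseteq> F" "span (?\<psi> ` {1..N}) = F"
    using F(3) span_superset[of "?\<psi> ` {1..N}"] by (auto simp only: span_flip)
  have k: "1 \<le> k" "k < l" using step.hyps step.prems by auto
  have "T k \<in> topes F N ?\<psi>" "T (Suc k) \<in> topes F N ?\<psi>" "adjacent F N ?\<psi> (T k) (T (Suc k))"
    using T k by (simp_all add: topes_flip adjacent_flip)
  then obtain f where f: "\<forall>a\<in>T k. \<forall>b\<in>T (Suc k). \<exists>m. crosses_wall F N ?\<psi> f a b m"
    "C = {i \<in> {1..N}. f (?\<psi> i) > 0}"
    using adjacent_functional[OF F(1) F'(1)] unfolding C_def by blast
  have "pt k \<in> T k" "pt (Suc k) \<in> T (Suc k)" using pt k by simp_all
  then obtain m where m: "crosses_wall F N ?\<psi> f (pt k) (pt (Suc k)) m" using f(1) by blast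
  then have lin: "linear f" by (simp add: crosses_wall_def)
  have AC: "flip_step F N \<psi> T A k = sym_diff A C" by (simp add: flip_step_def C_def)
  have BA: "sym_diff B A \<subseteq> {1..N}" using B step.prems(2) by blast
  have assoc: "sym_diff (sym_diff B A) C = sym_diff B (sym_diff A C)" by blast
  have cross: "w A k = w A (Suc k) - w (sym_diff A C) (Suc k)"
    using wall_crossing_formula[OF F(1) F' m BA f(2)] unfolding flip_flip assoc w_def .
  have sub: "sym_diff A C \<subseteq> {1..N}" using step.prems(2) f(2) by auto
  have pos: "positively_independent (flip (sym_diff A C) \<psi>) {1..N}"
    using positively_independent_flip[OF _ step.prems(3) lin f(2)] by (simp add: flip_flip)
  note IH1 = step.IH[of A, OF _ step.prems(2,3)] and IH2 = step.IH[of "sym_diff A C", OF _ sub pos]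
  have upt: "[k..<l] = k # [Suc k..<l]" using k(2) by (rule upt_conv_Cons)
  have fold: "foldl (flip_step F N \<psi> T) A (k # K) = foldl (flip_step F N \<psi> T) (sym_diff A C) K" for K
    by (simp add: AC)
  have "(\<Sum>K\<leftarrow>subseqs [k..<l]. (- 1) ^ length K * w (foldl (flip_step F N \<psi> T) A K) l)
    = - (\<Sum>K\<leftarrow>subseqs [Suc k..<l]. (- 1) ^ length K * w (foldl (flip_step F N \<psi> T) (sym_diff A C) K) l)
      + (\<Sum>K\<leftarrow>subseqs [Suc k..<l]. (- 1) ^ length K * w (foldl (flip_step F N \<psi> T) A K) l)"
    unfolding upt subseqs.simps Let_def
    by (simp add: o_def AC uminus_sum_list_map)
  moreover have "\<forall>K\<in>set (subseqs [k..<l]). foldl (flip_step F N \<psi> T) A K \<subseteq> {1..N}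
      \<and> positively_independent (flip (foldl (flip_step F N \<psi> T) A K) \<psi>) {1..N}"
    using IH1 IH2 unfolding upt subseqs.simps Let_def step_def set_append set_map
    by (intro ballI, elim UnE imageE) (simp_all add: AC)
  ultimately show ?case using cross IH1 IH2 unfolding step_def by simp
qed

text \<open>
  With respect to \<open>flip A \<psi>\<close> the coefficients of \<open>a\<close> are \<open>- x i\<close> for \<open>i \<in> A\<close> and \<open>x i\<close> otherwise;
  they are \<open>\<le> 0\<close> on \<open>sym_diff B A\<close> and \<open>\<ge> 0\<close> elsewhere.
\<close>

lemma signed_count_flip_orthant:
  fixes \<psi> :: "nat \<Rightarrow> 'a::euclidean_space"
  assumes F: "flip A \<psi> ` {1..N} \<subseteq> F" and gp: "general_position F (flip A \<psi>) {1..N} a"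
    and pos: "positively_independent (flip A \<psi>) {1..N}"
    and AB: "A \<subseteq> {1..N}" "B \<subseteq> {1..N}" and x: "x \<in> Q_neg N B" "a = (\<Sum>i\<in>{1..N}. x i *\<^sub>R \<psi> i)"
  shows "(- 1) ^ card (sym_diff B A) * signed_count {1..N} (\<lambda>I. a \<in> gen_cone (flip A \<psi>) I) (sym_diff B A)
    = of_bool (A = B) * (- 1) ^ dim F"
proof -
  define y where "y i = (if i \<in> A then - x i else x i)" for i
  have ya: "a = (\<Sum>i\<in>{1..N}. y i *\<^sub>R flip A \<psi> i)"
    unfolding x(2) by (rule sum.cong) (auto simp: y_def flip_def)
  have xB: "x i < 0" if "i \<in> B" for i using x(1) AB(2) that unfolding Q_neg_def by force
  have xN: "x i \<ge> 0" if "i \<in> {1..N}" "i \<notin> B" for i using x(1) that unfolding Q_neg_def by force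
  have y: "y i \<le> 0" if "i \<in> sym_diff B A" for i
    using that xB[of i] xN[of i] AB by (auto simp: y_def)
  have y': "y i \<ge> 0" if "i \<in> {1..N} - sym_diff B A" for i
    using that xB[of i] xN[of i] by (auto simp: y_def)
  show ?thesis
  proof (cases "A = B")
    case True
    then have e: "sym_diff B A = {}" by simp
    have "a \<in> gen_cone (flip A \<psi>) {1..N}" using y' ya unfolding e by (intro gen_coneI[of _ y]) auto
    then show ?thesis unfolding e using signed_count_empty[OF _ F gp pos] True by simp
  next
    case False
    then have C: "sym_diff B A \<subseteq> {1..N}" "sym_diff B A \<noteq> {}" using AB by auto
    show ?thesis
      using signed_count_orthant[OF finite_atLeastAtMost F gp pos C y y' ya] False by simp
  qed
qed

theorem theorem48:
  fixes F :: "'a::euclidean_space set" and \<phi> :: "nat \<Rightarrow> 'a"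
    and N r d :: nat and \<tau> :: "'a set"
  assumes "subspace F" and "dim F = r" and "d = N - r"
    and "\<forall>i\<in>{1..N}. \<phi> i \<in> F \<and> \<phi> i \<noteq> 0"
    and "span (\<phi> ` {1..N}) = F"
    and "salient (gen_cone \<phi> {1..N})"
    and "\<tau> \<in> topes F N \<phi>"
    and "\<tau> \<subseteq> gen_cone \<phi> {1..N}"
  shows "(BG_poly F N \<phi> \<tau> =
      (\<Sum>B\<in>Pow {1..N}.
        of_int (z_coeff F N \<phi> \<tau> B) * (\<Prod>i\<in>{1..N} - B. pvar i) * (\<Prod>i\<in>B. qvar i))) \<and>
    z_coeff F N \<phi> \<tau> {} = 1 \<and>
    z_coeff F N \<phi> \<tau> {1..N} = (- 1) ^ d \<and>
    (\<forall>B. B \<subseteq> {1..N} \<and> z_coeff F N \<phi> \<tau> B \<noteq> 0 \<longrightarrow> salient (gen_cone (flip B \<phi>) {1..N})) \<and>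
    (\<forall>B x \<nu> l T.
      B \<subseteq> {1..N} \<and> z_coeff F N \<phi> \<tau> B \<noteq> 0 \<and>
      x \<in> Q_neg N B \<and> (\<Sum>i\<in>{1..N}. x i *\<^sub>R \<phi> i) \<in> regular F N \<phi> \<and>
      \<nu> \<in> topes F N \<phi> \<and> (\<Sum>i\<in>{1..N}. x i *\<^sub>R \<phi> i) \<in> \<nu> \<and>
      tope_path F N \<phi> \<tau> \<nu> l T
      \<longrightarrow> B \<in> snd ` set (signed_list F N \<phi> l T) \<and>
          z_coeff F N \<phi> \<tau> B =
            (- 1) ^ card B * (\<Sum>(\<epsilon>, A) \<leftarrow> signed_list F N \<phi> l T. if A = B then \<epsilon> else 0))"
proof -
  have F: "subspace F" "\<phi> ` {1..N} \<subseteq> F" "span (\<phi> ` {1..N}) = F" using assms by auto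
  have pos: "positively_independent \<phi> {1..N}"
    using assms(4,6) by (intro positively_independent_if_salient) auto
  obtain a where a: "a \<in> \<tau>" using tope_nonempty[OF assms(7)] by blast
  have gpr: "general_position F \<phi> {1..N} b" if "b \<in> regular F N \<phi>" for b
    using that by (rule regular_general_position[OF F(1,3)])
  have gp: "general_position F \<phi> {1..N} a" using tope_subset_regular[OF assms(7)] a by (intro gpr) blast
  have z: "z_coeff F N \<phi> \<tau> B = (- 1) ^ dim F * signed_count {1..N} (\<lambda>I. b \<in> gen_cone \<phi> I) B"
    if "b \<in> \<tau>" "B \<subseteq> {1..N}" for b B
    by (rule z_coeff_eq[OF F assms(7) that])
  have sq: "(- 1) ^ n * ((- 1) ^ n * y) = (y :: int)" for n y
    by (simp add: mult.assoc[symmetric] flip: power_mult_distrib)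

  have poly: "BG_poly F N \<phi> \<tau> = (\<Sum>B\<in>Pow {1..N}.
      of_int (z_coeff F N \<phi> \<tau> B) * (\<Prod>i\<in>{1..N} - B. pvar i) * (\<Prod>i\<in>B. qvar i))"
    unfolding BG_poly_expansion[OF F assms(7) a] by (rule sum.cong[OF refl]) (simp add: z[OF a])

  have empty: "z_coeff F N \<phi> \<tau> {} = 1"
    using z[OF a] signed_count_empty[OF _ F(2) gp pos] a assms(8)
    by (auto simp flip: power_mult_distrib)

  have full: "z_coeff F N \<phi> \<tau> {1..N} = (- 1) ^ d"
  proof -
    have mem: "a \<in> gen_cone \<phi> {1..N}" using a assms(8) by blast
    have "signed_count {1..N} (\<lambda>I. a \<in> gen_cone \<phi> I) {1..N}
        = (\<Sum>I\<in>Pow {1..N}. if I = {1..N} then (- 1) ^ card I else 0)"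
      unfolding signed_count_def using mem by (intro sum.cong) auto
    also have "\<dots> = (- 1) ^ N" by simp
    finally have "z_coeff F N \<phi> \<tau> {1..N} = (- 1) ^ dim F * (- 1) ^ N" using z[OF a] by simp
    moreover have "dim F \<le> N"
      using general_position_card[OF gp, of "{1..N}"] gp F(3) by (simp add: general_position_def)
    then have "(- 1) ^ N = ((- 1) ^ dim F * (- 1) ^ d :: int)"
      using assms(2,3) by (metis le_add_diff_inverse power_add)
    ultimately show ?thesis by (simp only: sq)
  qed

  have sal: "salient (gen_cone (flip B \<phi>) {1..N})" if B: "B \<subseteq> {1..N}" and nz: "z_coeff F N \<phi> \<tau> B \<noteq> 0" for B
  proof (rule salient_if_positively_independent[OF finite_atLeastAtMost], rule ccontr)
    assume "\<not> positively_independent (flip B \<phi>) {1..N}"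
    then obtain t k where t: "\<forall>i\<in>{1..N}. t i \<ge> 0" "(\<Sum>i\<in>{1..N}. t i *\<^sub>R flip B \<phi> i) = 0"
      and k: "k \<in> {1..N}" "t k \<noteq> 0"
      unfolding positively_independent_def by blast
    define v where "v i = (if i \<in> B then - t i else t i)" for i
    have "(\<Sum>i\<in>{1..N}. v i *\<^sub>R \<phi> i) = (\<Sum>i\<in>{1..N}. t i *\<^sub>R flip B \<phi> i)"
      by (rule sum.cong) (auto simp: v_def flip_def)
    then have v0: "(\<Sum>i\<in>{1..N}. v i *\<^sub>R \<phi> i) = 0" using t(2) by simp
    have "signed_count {1..N} (\<lambda>I. a \<in> gen_cone \<phi> I) B = 0"
    proof (rule signed_count_recession[OF finite_atLeastAtMost F(2) gp pos B _ _ v0 k(1)])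
      show "v i \<le> 0" if "i \<in> B" for i using that B t(1) by (auto simp: v_def)
      show "v i \<ge> 0" if "i \<in> {1..N} - B" for i using that t(1) by (auto simp: v_def)
      show "v k \<noteq> 0" using k(2) by (simp add: v_def)
    qed
    then show False using nz z[OF a B] by simp
  qed

  have list: "B \<in> snd ` set (signed_list F N \<phi> l T) \<and>
      z_coeff F N \<phi> \<tau> B = (- 1) ^ card B * (\<Sum>(\<epsilon>, A) \<leftarrow> signed_list F N \<phi> l T. if A = B then \<epsilon> else 0)"
    if B: "B \<subseteq> {1..N}" and nz: "z_coeff F N \<phi> \<tau> B \<noteq> 0" and x: "x \<in> Q_neg N B"
      and reg: "(\<Sum>i\<in>{1..N}. x i *\<^sub>R \<phi> i) \<in> regular F N \<phi>"
      and \<nu>: "(\<Sum>i\<in>{1..N}. x i *\<^sub>R \<phi> i) \<in> \<nu>" and path: "tope_path F N \<phi> \<tau> \<nu> l T"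
    for B x \<nu> l T
  proof -
    define p where "p = (\<Sum>i\<in>{1..N}. x i *\<^sub>R \<phi> i)"
    have l: "1 \<le> l" and T1: "T 1 = \<tau>" and Tl: "T l = \<nu>"
      and T: "\<And>j. \<lbrakk>1 \<le> j; j \<le> l\<rbrakk> \<Longrightarrow> T j \<in> topes F N \<phi>" "\<And>j. \<lbrakk>1 \<le> j; j < l\<rbrakk> \<Longrightarrow> adjacent F N \<phi> (T j) (T (Suc j))"
      using path by (auto simp: tope_path_def)
    \<comment> \<open>the final point has to be \<open>p\<close>; if \<open>l = 1\<close> it is at the same time the initial point in \<open>\<tau>\<close>\<close>
    define pt where "pt j = (if j = l then p else SOME q. q \<in> T j)" for j
    have pt: "pt j \<in> T j" if "1 \<le> j" "j \<le> l" for j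
      using \<nu> Tl tope_nonempty[OF T(1)[OF that]] by (auto simp: pt_def p_def some_in_eq)
    define A where "A K = foldl (flip_step F N \<phi> T) {} K" for K
    let ?w = "\<lambda>C j. (- 1) ^ card (sym_diff B C)
      * signed_count {1..N} (\<lambda>I. pt j \<in> gen_cone (flip C \<phi>) I) (sym_diff B C)"
    have flip0: "flip {} \<phi> = \<phi>" by (simp add: flip_def)
    have exp: "?w {} 1 = (\<Sum>K\<leftarrow>subseqs [1..<l]. (- 1) ^ length K * ?w (A K) l)"
      and A: "\<And>K. K \<in> set (subseqs [1..<l]) \<Longrightarrow> A K \<subseteq> {1..N} \<and> positively_independent (flip (A K) \<phi>) {1..N}"
      using path_expansion[where T = T and pt = pt and l = l and k = 1 and A = "{}", OF F T pt B order_refl l]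
        pos unfolding flip0 A_def by auto
    have "?w (A K) l = of_bool (A K = B) * (- 1) ^ dim F" if K: "K \<in> set (subseqs [1..<l])" for K
    proof -
      have F': "flip (A K) \<phi> ` {1..N} \<subseteq> F"
        using F(3) span_superset[of "flip (A K) \<phi> ` {1..N}"] by (auto simp only: span_flip)
      have gp': "general_position F (flip (A K) \<phi>) {1..N} p"
        using reg F(3) by (intro regular_general_position[OF F(1)]) (simp_all add: p_def span_flip regular_flip)
      have "pt l = p" by (simp add: pt_def)
      then show ?thesis
        using signed_count_flip_orthant[OF F' gp' _ _ B x p_def] A[OF K] by simp
    qed
    then have "(\<Sum>K\<leftarrow>subseqs [1..<l]. (- 1) ^ length K * ?w (A K) l)
        = (\<Sum>K\<leftarrow>subseqs [1..<l]. (if A K = B then (- 1) ^ length K else 0) * (- 1) ^ dim F)"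
      by (intro arg_cong[of _ _ sum_list] map_cong) auto
    also have "\<dots> = (\<Sum>(\<epsilon>, C) \<leftarrow> signed_list F N \<phi> l T. if C = B then \<epsilon> else 0) * (- 1) ^ dim F"
      by (simp add: sum_list_mult_const signed_list_def o_def flip_set_eq_foldl A_def)
    finally have sum: "(- 1) ^ card B * signed_count {1..N} (\<lambda>I. pt 1 \<in> gen_cone \<phi> I) B
        = (\<Sum>(\<epsilon>, C) \<leftarrow> signed_list F N \<phi> l T. if C = B then \<epsilon> else 0) * (- 1) ^ dim F"
      using exp flip0 by simp
    have "pt 1 \<in> \<tau>" using pt[of 1] l T1 by simp
    then have "z_coeff F N \<phi> \<tau> B = (- 1) ^ card B * ((- 1) ^ dim F
        * ((- 1) ^ card B * signed_count {1..N} (\<lambda>I. pt 1 \<in> gen_cone \<phi> I) B))"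
      using z[OF _ B] sq[of "card B"] by (simp add: mult.left_commute)
    then have main: "z_coeff F N \<phi> \<tau> B
        = (- 1) ^ card B * (\<Sum>(\<epsilon>, C) \<leftarrow> signed_list F N \<phi> l T. if C = B then \<epsilon> else 0)"
      unfolding sum using sq[of "dim F"] by (simp add: mult.commute)
    have "B \<in> snd ` set (signed_list F N \<phi> l T)"
    proof (rule ccontr)
      assume no: "B \<notin> snd ` set (signed_list F N \<phi> l T)"
      have "(\<Sum>(\<epsilon>, C) \<leftarrow> signed_list F N \<phi> l T. if C = B then \<epsilon> else 0)
          = (\<Sum>(\<epsilon>, C) \<leftarrow> signed_list F N \<phi> l T. 0)"
        using no by (intro arg_cong[of _ _ sum_list] map_cong) force+
      also have "\<dots> = 0" by (simp add: case_prod_unfold)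
      finally show False using main nz by simp
    qed
    then show ?thesis using main by blast
  qed
  show ?thesis using poly empty full sal list by blast
qed

end
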